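(* Let $M$ be a smooth manifold, $\mathbb TM = TM\oplus T^*M$, and let $\mathcal G_0$ be the natural generalized metric on $\mathbb TM$. (i) For every generalized metric $\mathcal G\colon \Gamma(\mathbb TM)\times\Gamma(\mathbb TM)\to\mathfrak F(M)$ there is an injective endomorphism $\mathcal K\colon\Gamma(\mathbb TM)\to\Gamma(\mathbb TM)$ such that $$\mathcal G(X+\xi,Y+\eta)=\mathcal G_0(\mathcal K(X+\xi),Y+\eta)\qquad (\ast)$$ for all $X+\xi,\,Y+\eta\in\Gamma(\mathbb TM)$. In matrix notation $\mathcal K$ has the form $$\mathcal K=\begin{pmatrix}H&\sigma\\ \tau&H^*\end{pmatrix},$$ where $H\colon\mathfrak X(M)\to\mathfrak X(M)$, $\sigma\colon\Lambda^1(M)\to\mathfrak X(M)$, $\tau\colon\mathfrak X(M)\to\Lambda^1(M)$ satisfy $(\tau X)(Y)=(\tau Y)(X)$ and $\xi(\sigma\eta)=\eta(\sigma\xi)$ for all $X,Y\in\mathfrak X(M)$ and $\xi,\eta\in\Lambda^1(M)$. (ii) Conversely, each injective endomorphism $\mathcal K$ of $\Gamma(\mathbb TM)$ of this matrix form, with $\tau$ and $\sigma$ satisfying these symmetry conditions, induces a generalized metric $\mathcal G$ defined by $(\ast)$.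
   Context: $\mathfrak F(M)$ is the ring of smooth real functions on $M$; $\mathfrak X(M)$ and $\Lambda^1(M)$ are the $\mathfrak F(M)$-modules of vector fields and of 1-forms. Sections of $\mathbb TM=TM\oplus T^*M$ are written $X+\xi\in\Gamma(\mathbb TM)=\mathfrak X(M)\oplus\Lambda^1(M)$. All endomorphisms and component maps are $\mathfrak F(M)$-linear. A generalized metric is an $\mathfrak F(M)$-bilinear, symmetric, nondegenerate map $\mathcal G\colon\Gamma(\mathbb TM)\times\Gamma(\mathbb TM)\to\mathfrak F(M)$, where nondegenerate means: if $\mathcal G(u,v)=0$ for all $v\in\Gamma(\mathbb TM)$, then $u=0$. The natural generalized metric is $\mathcal G_0(X+\xi,Y+\eta)=\frac12(\xi(Y)+\eta(X))$. Matrix notation: $\begin{pmatrix}H&\sigma\\ \tau&K\end{pmatrix}(X+\xi)=(HX+\sigma\xi)+(\tau X+K\xi)$. For $H\colon\mathfrak X(M)\to\mathfrak X(M)$, the dual $H^*\colon\Lambda^1(M)\to\Lambda^1(M)$ is $(H^*\xi)(X)=\xi(HX)$. *)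

theory Defs
  imports "HOL-Analysis.Analysis" "HOL-Library.Function_Algebras"
begin

section \<open>Smooth maps between normed spaces\<close>

text \<open>These notions are meant for open \<open>S\<close> in a finite-dimensional space, where they are the usual
  \<open>C\<^sup>k\<close> and \<open>C\<^sup>\<infinity>\<close>: the second clause says that all directional derivatives are of class \<open>C\<^sup>k\<close>.\<close>

fun Ck_on :: "nat \<Rightarrow> ('a::real_normed_vector \<Rightarrow> 'b::real_normed_vector) \<Rightarrow> 'a set \<Rightarrow> bool" where
  "Ck_on 0 f S \<longleftrightarrow> continuous_on S f"
| "Ck_on (Suc k) f S \<longleftrightarrow>
     (\<forall>x\<in>S. f differentiable (at x)) \<and> (\<forall>v. Ck_on k (\<lambda>x. frechet_derivative f (at x) v) S)"

definition smooth_on :: "'a set \<Rightarrow> ('a::real_normed_vector \<Rightarrow> 'b::real_normed_vector) \<Rightarrow> bool" where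
  "smooth_on S f \<longleftrightarrow> (\<forall>k. Ck_on k f S)"


section \<open>Smooth manifolds\<close>

text \<open>A chart is a pair of its domain and its coordinate map; the values of the coordinate map
  outside the domain are irrelevant.\<close>

type_synonym ('a, 'e) chart = "'a set \<times> ('a \<Rightarrow> 'e)"

definition is_chart :: "'a topology \<Rightarrow> ('a, 'e::real_normed_vector) chart \<Rightarrow> bool" where
  "is_chart M c \<longleftrightarrow> openin M (fst c) \<and> open (snd c ` fst c) \<and>
     homeomorphic_map (subtopology M (fst c)) (top_of_set (snd c ` fst c)) (snd c)"

definition chart_inv :: "('a, 'e) chart \<Rightarrow> 'e \<Rightarrow> 'a" where
  "chart_inv c = inv_into (fst c) (snd c)"

definition transition :: "('a, 'e) chart \<Rightarrow> ('a, 'e) chart \<Rightarrow> 'e \<Rightarrow> 'e" where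
  "transition c d = snd d \<circ> chart_inv c"

definition smooth_atlas :: "'a topology \<Rightarrow> ('a, 'e::real_normed_vector) chart set \<Rightarrow> bool" where
  "smooth_atlas M A \<longleftrightarrow>
     (\<forall>c\<in>A. is_chart M c) \<and> \<Union> (fst ` A) = topspace M \<and>
     (\<forall>c\<in>A. \<forall>d\<in>A. smooth_on (snd c ` (fst c \<inter> fst d)) (transition c d))"

text \<open>The model space is an arbitrary finite-dimensional inner product space \<open>'e\<close>, that is, \<open>\<real>\<^sup>n\<close>.
  The class \<open>euclidean_space\<close> would exclude dimension \<open>0\<close>.\<close>

definition smooth_manifold :: "'a topology \<Rightarrow> ('a, 'e::real_inner) chart set \<Rightarrow> bool" where
  "smooth_manifold M A \<longleftrightarrow>
     (\<exists>B::'e set. finite B \<and> span B = UNIV) \<and>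
     Hausdorff_space M \<and> second_countable M \<and> smooth_atlas M A"


section \<open>Functions, vector fields and 1-forms\<close>

text \<open>All objects on the manifold are total functions, normalised to be \<open>0\<close> outside their domain, so
  that equality of HOL functions is equality of the objects. Sums, products and \<open>0\<close> are the pointwise
  ones.\<close>

definition smooth_functions :: "'a topology \<Rightarrow> ('a, 'e::real_normed_vector) chart set \<Rightarrow> ('a \<Rightarrow> real) set"
  where "smooth_functions M A =
    {f. (\<forall>p. p \<notin> topspace M \<longrightarrow> f p = 0) \<and>
        (\<forall>c\<in>A. smooth_on (snd c ` fst c) (f \<circ> chart_inv c))}"

text \<open>A tangent vector at \<open>p\<close> assigns to each chart around \<open>p\<close> its component vector, the components
  being related by the derivatives of the transition maps. For \<open>p\<close> outside the manifold this is
  the zero space.\<close>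

type_synonym ('a, 'e) tvec = "('a, 'e) chart \<Rightarrow> 'e"

definition tangent_space ::
    "('a, 'e::real_normed_vector) chart set \<Rightarrow> 'a \<Rightarrow> ('a, 'e) tvec set" where
  "tangent_space A p =
    {v. (\<forall>c. \<not> (c \<in> A \<and> p \<in> fst c) \<longrightarrow> v c = 0) \<and>
        (\<forall>c\<in>A. \<forall>d\<in>A. p \<in> fst c \<inter> fst d \<longrightarrow>
           v d = frechet_derivative (transition c d) (at (snd c p)) (v c))}"

definition cotangent_space ::
    "('a, 'e::real_normed_vector) chart set \<Rightarrow> 'a \<Rightarrow> (('a, 'e) tvec \<Rightarrow> real) set" where
  "cotangent_space A p =
    {\<alpha>. (\<forall>v. v \<notin> tangent_space A p \<longrightarrow> \<alpha> v = 0) \<and>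
        (\<forall>v\<in>tangent_space A p. \<forall>w\<in>tangent_space A p. \<alpha> (v + w) = \<alpha> v + \<alpha> w) \<and>
        (\<forall>r. \<forall>v\<in>tangent_space A p. \<alpha> (\<lambda>c. r *\<^sub>R v c) = r * \<alpha> v)}"

text \<open>For \<open>p\<close> in the domain of \<open>c\<close>: the tangent vector at \<open>p\<close> whose component in the chart \<open>c\<close> is \<open>e\<close>
  (the coordinate vector \<open>\<partial>/\<partial>x\<^sup>i\<close> if \<open>e\<close> is the \<open>i\<close>-th basis vector).\<close>

definition coord_vector ::
    "('a, 'e::real_normed_vector) chart set \<Rightarrow> ('a, 'e) chart \<Rightarrow> 'e \<Rightarrow> 'a \<Rightarrow> ('a, 'e) tvec" where
  "coord_vector A c e p =
    (\<lambda>d. if d \<in> A \<and> p \<in> fst d then frechet_derivative (transition c d) (at (snd c p)) e else 0)"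

type_synonym ('a, 'e) vfield = "'a \<Rightarrow> ('a, 'e) tvec"
type_synonym ('a, 'e) oneform = "'a \<Rightarrow> ('a, 'e) tvec \<Rightarrow> real"

text \<open>Smooth sections of the tangent and cotangent bundles: the components in every chart are
  smooth.\<close>

definition vector_fields :: "('a, 'e::real_normed_vector) chart set \<Rightarrow> ('a, 'e) vfield set" where
  "vector_fields A =
    {X. (\<forall>p. X p \<in> tangent_space A p) \<and>
        (\<forall>c\<in>A. smooth_on (snd c ` fst c) (\<lambda>x. X (chart_inv c x) c))}"

definition one_forms :: "('a, 'e::real_normed_vector) chart set \<Rightarrow> ('a, 'e) oneform set" where
  "one_forms A =
    {\<xi>. (\<forall>p. \<xi> p \<in> cotangent_space A p) \<and>
        (\<forall>c\<in>A. \<forall>e. smooth_on (snd c ` fst c)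
           (\<lambda>x. \<xi> (chart_inv c x) (coord_vector A c e (chart_inv c x))))}"

definition pairing :: "('a, 'e) oneform \<Rightarrow> ('a, 'e) vfield \<Rightarrow> 'a \<Rightarrow> real" where
  "pairing \<xi> X = (\<lambda>p. \<xi> p (X p))"

text \<open>Multiplication by a function, for vector fields as well as for 1-forms.\<close>

definition fscale :: "('a \<Rightarrow> real) \<Rightarrow> ('a \<Rightarrow> 'i \<Rightarrow> 'v::real_vector) \<Rightarrow> 'a \<Rightarrow> 'i \<Rightarrow> 'v" where
  "fscale f X = (\<lambda>p i. f p *\<^sub>R X p i)"


section \<open>The generalized tangent bundle\<close>

type_synonym ('a, 'e) gsection = "('a, 'e) vfield \<times> ('a, 'e) oneform"

definition sections :: "('a, 'e::real_normed_vector) chart set \<Rightarrow> ('a, 'e) gsection set" where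
  "sections A = vector_fields A \<times> one_forms A"

definition fscale_section ::
    "('a \<Rightarrow> real) \<Rightarrow> ('a, 'e::real_vector) gsection \<Rightarrow> ('a, 'e) gsection" where
  "fscale_section f u = (fscale f (fst u), fscale f (snd u))"

definition module_map ::
    "'f set \<Rightarrow> ('f \<Rightarrow> 'v \<Rightarrow> 'v) \<Rightarrow> 'v::plus set \<Rightarrow> ('f \<Rightarrow> 'w \<Rightarrow> 'w) \<Rightarrow> 'w::plus set \<Rightarrow> ('v \<Rightarrow> 'w) \<Rightarrow> bool"
  where "module_map F s V t W T \<longleftrightarrow>
    (\<forall>u\<in>V. T u \<in> W) \<and> (\<forall>u\<in>V. \<forall>v\<in>V. T (u + v) = T u + T v) \<and>
    (\<forall>f\<in>F. \<forall>u\<in>V. T (s f u) = t f (T u))"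

definition generalized_metric ::
    "'a topology \<Rightarrow> ('a, 'e::real_normed_vector) chart set \<Rightarrow>
     (('a, 'e) gsection \<Rightarrow> ('a, 'e) gsection \<Rightarrow> 'a \<Rightarrow> real) \<Rightarrow> bool" where
  "generalized_metric M A G \<longleftrightarrow>
    (\<forall>u\<in>sections A.
       module_map (smooth_functions M A) fscale_section (sections A)
         times (smooth_functions M A) (\<lambda>v. G u v)) \<and>
    (\<forall>v\<in>sections A.
       module_map (smooth_functions M A) fscale_section (sections A)
         times (smooth_functions M A) (\<lambda>u. G u v)) \<and>
    (\<forall>u\<in>sections A. \<forall>v\<in>sections A. G u v = G v u) \<and>
    (\<forall>u\<in>sections A. (\<forall>v\<in>sections A. G u v = 0) \<longrightarrow> u = 0)"

definition natural_metric :: "('a, 'e) gsection \<Rightarrow> ('a, 'e) gsection \<Rightarrow> 'a \<Rightarrow> real" where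
  "natural_metric u v = (\<lambda>p. (1/2) * (pairing (snd u) (fst v) p + pairing (snd v) (fst u) p))"

definition injective_endomorphism ::
    "'a topology \<Rightarrow> ('a, 'e::real_normed_vector) chart set \<Rightarrow>
     (('a, 'e) gsection \<Rightarrow> ('a, 'e) gsection) \<Rightarrow> bool" where
  "injective_endomorphism M A K \<longleftrightarrow>
    module_map (smooth_functions M A) fscale_section (sections A) fscale_section (sections A) K \<and>
    inj_on K (sections A)"

definition dual_map ::
    "('a, 'e::real_normed_vector) chart set \<Rightarrow> (('a, 'e) vfield \<Rightarrow> ('a, 'e) vfield) \<Rightarrow>
     ('a, 'e) oneform \<Rightarrow> ('a, 'e) oneform" where
  "dual_map A H \<xi> =
    (THE \<zeta>. \<zeta> \<in> one_forms A \<and> (\<forall>X\<in>vector_fields A. pairing \<zeta> X = pairing \<xi> (H X)))"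

definition symmetric_matrix_form ::
    "'a topology \<Rightarrow> ('a, 'e::real_normed_vector) chart set \<Rightarrow>
     (('a, 'e) gsection \<Rightarrow> ('a, 'e) gsection) \<Rightarrow>
     (('a, 'e) vfield \<Rightarrow> ('a, 'e) vfield) \<Rightarrow>
     (('a, 'e) oneform \<Rightarrow> ('a, 'e) vfield) \<Rightarrow>
     (('a, 'e) vfield \<Rightarrow> ('a, 'e) oneform) \<Rightarrow> bool" where
  "symmetric_matrix_form M A K H \<sigma> \<tau> \<longleftrightarrow>
    module_map (smooth_functions M A) fscale (vector_fields A) fscale (vector_fields A) H \<and>
    module_map (smooth_functions M A) fscale (one_forms A) fscale (vector_fields A) \<sigma> \<and>
    module_map (smooth_functions M A) fscale (vector_fields A) fscale (one_forms A) \<tau> \<and>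
    (\<forall>X\<in>vector_fields A. \<forall>Y\<in>vector_fields A. pairing (\<tau> X) Y = pairing (\<tau> Y) X) \<and>
    (\<forall>\<xi>\<in>one_forms A. \<forall>\<eta>\<in>one_forms A. pairing \<xi> (\<sigma> \<eta>) = pairing \<eta> (\<sigma> \<xi>)) \<and>
    (\<forall>X\<in>vector_fields A. \<forall>\<xi>\<in>one_forms A.
       K (X, \<xi>) = (H X + \<sigma> \<xi>, \<tau> X + dual_map A H \<xi>))"

end

theory Submission
  imports Defs
begin

text \<open>
  Near every point \<open>q\<close> choose a bump function \<open>\<psi>\<close> supported in a chart and multiply the coordinate
  fields and forms by it: \<open>X\<^sub>b = \<psi> \<partial>\<^sub>b\<close> and \<open>\<theta>\<^sub>b = \<psi> dx\<^sub>b\<close> are global sections with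
  \<open>\<psi>\<^sup>2 Y = \<Sum>\<^sub>b \<theta>\<^sub>b(Y) X\<^sub>b\<close> and \<open>\<psi>\<^sup>2 \<xi> = \<Sum>\<^sub>b \<xi>(X\<^sub>b) \<theta>\<^sub>b\<close>. Hence, for a function-linear functional \<open>L\<close> on vector
  fields, \<open>\<psi>\<^sup>2 L\<close> is the pairing with the smooth form \<open>\<Sum>\<^sub>b L(X\<^sub>b) \<theta>\<^sub>b\<close>; dividing by \<open>\<psi>\<^sup>2\<close> near \<open>q\<close> and using
  that sections are determined by their pairings, these forms glue to one smooth form representing
  \<open>L\<close>. The same works for functionals on 1-forms, so vector fields and 1-forms are dual modules,
  without any partition of unity. Consequently each \<open>\<G>(u, \<cdot>)\<close> is \<open>\<G>\<^sub>0(\<K> u, \<cdot>)\<close> for a unique \<open>\<K> u\<close>;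
  uniqueness makes \<open>\<K>\<close> linear, nondegeneracy of \<open>\<G>\<close> is injectivity of \<open>\<K>\<close>, and symmetry of \<open>\<G>\<close> is
  the matrix form.
\<close>

section \<open>Calculus of smooth maps\<close>

text \<open>On an open \<open>S\<close> the derivative at a point of \<open>S\<close> depends only
  on the values on \<open>S\<close>, so the directional derivatives of \<open>f\<close> and
  \<open>g\<close> agree there and the induction on \<open>k\<close> passes to them.\<close>

lemma Ck_on_cong:
  assumes "open S" "\<And>x. x \<in> S \<Longrightarrow> f x = g x" "Ck_on k f S"
  shows "Ck_on k g S"
  using assms(2,3)
proof (induction k arbitrary: f g)
  case 0
  then show ?case by (simp cong: continuous_on_cong)
next
  case (Suc k)
  have "frechet_derivative f (at x) v = frechet_derivative g (at x) v" if "x \<in> S" for x v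
    using frechet_derivative_transform_within_open[of f x S g] Suc.prems that assms(1) by simp
  then have "Ck_on k (\<lambda>x. frechet_derivative g (at x) v) S" for v
    using Suc.IH[of "\<lambda>x. frechet_derivative f (at x) v"] Suc.prems(2) by simp
  moreover have "g differentiable (at x)" if "x \<in> S" for x
    using Suc.prems that assms(1) has_derivative_transform_within_open[of f _ x UNIV S g]
    unfolding differentiable_def by (metis Ck_on.simps(2) differentiable_def)
  ultimately show ?case by simp
qed

text \<open>Lets an inductive proof exhibit the derivative by any convenient formula; uniqueness of
  derivatives identifies it with \<open>frechet_derivative\<close>.\<close>

lemma Ck_on_Suc_derivI:
  assumes "\<And>x. x \<in> S \<Longrightarrow> (f has_derivative f' x) (at x)"
    and "\<And>v. Ck_on k (\<lambda>x. f' x v) S" and "open S"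
  shows "Ck_on (Suc k) f S"
proof -
  have "f' x v = frechet_derivative f (at x) v" if "x \<in> S" for x v
    using frechet_derivative_at[OF assms(1)[OF that]] by simp
  then have "Ck_on k (\<lambda>x. frechet_derivative f (at x) v) S" for v
    by (rule Ck_on_cong[OF assms(3) _ assms(2)])
  then show ?thesis
    using assms(1) by (auto simp: differentiable_def)
qed

lemma Ck_on_Suc_has_derivative:
  "Ck_on (Suc k) f S \<Longrightarrow> x \<in> S \<Longrightarrow> (f has_derivative frechet_derivative f (at x)) (at x)"
  by (simp add: frechet_derivative_works)

lemma Ck_on_subset: "Ck_on k f S \<Longrightarrow> T \<subseteq> S \<Longrightarrow> Ck_on k f T"
  by (induction k arbitrary: f) (auto intro: continuous_on_subset)

text \<open>Differentiability is a condition at single points and continuity can be tested on open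
  neighbourhoods; the induction carries this to all derivatives.\<close>

lemma Ck_on_locally:
  assumes "\<And>x. x \<in> S \<Longrightarrow> \<exists>T. open T \<and> x \<in> T \<and> Ck_on k f T"
  shows "Ck_on k f S"
  using assms
proof (induction k arbitrary: f)
  case 0
  then show ?case
    by (metis Ck_on.simps(1) continuous_at_imp_continuous_on continuous_on_eq_continuous_at)
next
  case (Suc k)
  then show ?case by (metis Ck_on.simps(2))
qed

text \<open>Differentiable maps are continuous, which settles \<open>k = 0\<close>. In the product
  and chain rules this brings an undifferentiated factor down to the class of the
  derivative.\<close>

lemma Ck_on_SucD: "Ck_on (Suc k) f S \<Longrightarrow> Ck_on k f S"
proof (induction k arbitrary: f)
  case 0
  then show ?case
    by (auto intro!: continuous_at_imp_continuous_on differentiable_imp_continuous_within)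
next
  case (Suc k)
  then show ?case by (metis Ck_on.simps(2))
qed

lemma Ck_on_const: "Ck_on k (\<lambda>x. c) S"
  by (induction k arbitrary: c) auto

section \<open>Closure of the classes C^k under algebraic operations\<close>

lemma Ck_on_bounded_linear:
  assumes "bounded_linear h" "Ck_on k f S" "open S"
  shows "Ck_on k (\<lambda>x. h (f x)) S"
  using assms(2)
proof (induction k arbitrary: f)
  case 0
  then show ?case using bounded_linear.continuous_on[OF assms(1)] by auto
next
  case (Suc k)
  show ?case
    by (rule Ck_on_Suc_derivI,
        rule bounded_linear.has_derivative[OF assms(1) Ck_on_Suc_has_derivative[OF Suc.prems]])
       (use Suc \<open>open S\<close> in auto)
qed

lemma Ck_on_add:
  assumes "Ck_on k f S" "Ck_on k g S" "open S"
  shows "Ck_on k (\<lambda>x. f x + g x) S"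
  using assms(1,2)
proof (induction k arbitrary: f g)
  case 0
  then show ?case by (simp add: continuous_on_add)
next
  case (Suc k)
  show ?case
    by (rule Ck_on_Suc_derivI,
        rule has_derivative_add[OF Suc.prems[THEN Ck_on_Suc_has_derivative]])
       (use Suc \<open>open S\<close> in auto)
qed

text \<open>Leibniz rule: each summand of the derivative has one differentiated and one
  undifferentiated argument, and the induction hypothesis applies to both summands. The abstract
  form covers multiplication, scaling and inner products at once.\<close>

lemma Ck_on_bilinear:
  assumes "bounded_bilinear h" "Ck_on k f S" "Ck_on k g S" "open S"
  shows "Ck_on k (\<lambda>x. h (f x) (g x)) S"
  using assms(2,3)
proof (induction k arbitrary: f g)
  case 0
  then show ?case using bounded_bilinear.continuous_on[OF assms(1)] by auto
next
  case (Suc k)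
  show ?case
  proof (rule Ck_on_Suc_derivI)
    show "((\<lambda>x. h (f x) (g x)) has_derivative (\<lambda>v. h (f x) (frechet_derivative g (at x) v) + h (frechet_derivative f (at x) v) (g x))) (at x)"
      if "x \<in> S" for x
      by (rule bounded_bilinear.FDERIV[OF assms(1) Suc.prems[THEN Ck_on_Suc_has_derivative, OF that]])
    show "Ck_on k (\<lambda>x. h (f x) (frechet_derivative g (at x) v) + h (frechet_derivative f (at x) v) (g x)) S" for v
      using Suc Ck_on_SucD[OF Suc.prems(1)] Ck_on_SucD[OF Suc.prems(2)] \<open>open S\<close>
      by (auto intro!: Ck_on_add)
  qed fact
qed

text \<open>The derivative is minus the derivative of \<open>f\<close> times the square of 1/f. The
  induction hypothesis covers 1/f itself, so this is a product of C^k functions.\<close>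

lemma Ck_on_inverse:
  fixes f :: "'a::real_normed_vector \<Rightarrow> real"
  assumes "Ck_on k f S" "open S" "\<And>x. x \<in> S \<Longrightarrow> f x \<noteq> 0"
  shows "Ck_on k (\<lambda>x. inverse (f x)) S"
  using assms(1)
proof (induction k)
  case 0
  then show ?case using assms(3) by (simp add: continuous_on_inverse)
next
  case (Suc k)
  show ?case
  proof (rule Ck_on_Suc_derivI)
    show "((\<lambda>x. inverse (f x)) has_derivative (\<lambda>v. - (inverse (f x) * frechet_derivative f (at x) v * inverse (f x)))) (at x)"
      if "x \<in> S" for x
      by (rule Deriv.has_derivative_inverse[OF assms(3)[OF that] Ck_on_Suc_has_derivative[OF Suc.prems that]])
    show "Ck_on k (\<lambda>x. - (inverse (f x) * frechet_derivative f (at x) v * inverse (f x))) S" for v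
      using Suc Ck_on_SucD[OF Suc.prems(1)] \<open>open S\<close>
      by (auto intro!: Ck_on_bounded_linear[OF bounded_linear_minus[OF bounded_linear_ident]]
          Ck_on_bilinear[OF bounded_bilinear_mult])
  qed fact
qed

section \<open>The same rules for smooth maps\<close>

lemma smooth_onI: "(\<And>k. Ck_on k f S) \<Longrightarrow> smooth_on S f"
  by (simp add: smooth_on_def)

lemma smooth_onD: "smooth_on S f \<Longrightarrow> Ck_on k f S"
  by (simp add: smooth_on_def)

lemma smooth_on_differentiable: "smooth_on S f \<Longrightarrow> x \<in> S \<Longrightarrow> f differentiable (at x)"
  using smooth_onD[of S f "Suc 0"] by auto

lemma smooth_on_derivative: "smooth_on S f \<Longrightarrow> smooth_on S (\<lambda>x. frechet_derivative f (at x) v)"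
  by (rule smooth_onI) (metis Ck_on.simps(2) smooth_onD)

lemma smooth_on_cong:
  "smooth_on S f \<Longrightarrow> open S \<Longrightarrow> (\<And>x. x \<in> S \<Longrightarrow> f x = g x) \<Longrightarrow> smooth_on S g"
  by (rule smooth_onI, rule Ck_on_cong[of S f]) (auto dest: smooth_onD)

lemma smooth_on_subset: "smooth_on S f \<Longrightarrow> T \<subseteq> S \<Longrightarrow> smooth_on T f"
  unfolding smooth_on_def by (blast intro: Ck_on_subset)

lemma smooth_on_locally:
  "(\<And>x. x \<in> S \<Longrightarrow> \<exists>T. open T \<and> x \<in> T \<and> smooth_on T f) \<Longrightarrow> smooth_on S f"
  by (rule smooth_onI, rule Ck_on_locally) (metis smooth_onD)

lemma smooth_on_const: "smooth_on S (\<lambda>x. c)"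
  by (simp add: smooth_on_def Ck_on_const)

lemma smooth_on_ident: "smooth_on S (\<lambda>x. x)"
proof (rule smooth_onI)
  show "Ck_on k (\<lambda>x. x) S" for k
    by (cases k) (auto intro: Ck_on_const continuous_on_id)
qed

lemma smooth_on_bounded_linear:
  "bounded_linear h \<Longrightarrow> smooth_on S f \<Longrightarrow> open S \<Longrightarrow> smooth_on S (\<lambda>x. h (f x))"
  by (rule smooth_onI, rule Ck_on_bounded_linear) (auto dest: smooth_onD)

lemma smooth_on_add:
  "smooth_on S f \<Longrightarrow> smooth_on S g \<Longrightarrow> open S \<Longrightarrow> smooth_on S (\<lambda>x. f x + g x)"
  by (rule smooth_onI, rule Ck_on_add) (auto dest: smooth_onD)

lemma smooth_on_bilinear:
  "bounded_bilinear h \<Longrightarrow> smooth_on S f \<Longrightarrow> smooth_on S g \<Longrightarrow> open S \<Longrightarrow> smooth_on S (\<lambda>x. h (f x) (g x))"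
  by (rule smooth_onI, rule Ck_on_bilinear) (auto dest: smooth_onD)

lemmas smooth_on_mult = smooth_on_bilinear[OF bounded_bilinear_mult]
lemmas smooth_on_scaleR = smooth_on_bilinear[OF bounded_bilinear_scaleR]
lemmas smooth_on_inner = smooth_on_bilinear[OF bounded_bilinear_inner]

lemmas smooth_on_minus = smooth_on_bounded_linear[OF bounded_linear_minus[OF bounded_linear_ident]]

lemma smooth_on_diff:
  "smooth_on S f \<Longrightarrow> smooth_on S g \<Longrightarrow> open S \<Longrightarrow> smooth_on S (\<lambda>x. f x - g x)"
  unfolding diff_conv_add_uminus by (intro smooth_on_add smooth_on_minus)

lemma smooth_on_inverse:
  fixes f :: "'a::real_normed_vector \<Rightarrow> real"
  shows "smooth_on S f \<Longrightarrow> open S \<Longrightarrow> (\<And>x. x \<in> S \<Longrightarrow> f x \<noteq> 0) \<Longrightarrow> smooth_on S (\<lambda>x. inverse (f x))"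
  by (rule smooth_onI, rule Ck_on_inverse) (auto dest: smooth_onD)

lemma Ck_on_sum:
  assumes "\<And>i. i \<in> I \<Longrightarrow> Ck_on k (f i) S" "open S"
  shows "Ck_on k (\<lambda>x. \<Sum>i\<in>I. f i x) S"
  using assms(1)
  by (induction I rule: infinite_finite_induct) (auto intro: Ck_on_const Ck_on_add assms(2))

lemma smooth_on_sum:
  "(\<And>i. i \<in> I \<Longrightarrow> smooth_on S (f i)) \<Longrightarrow> open S \<Longrightarrow> smooth_on S (\<lambda>x. \<Sum>i\<in>I. f i x)"
  by (rule smooth_onI, rule Ck_on_sum) (auto dest: smooth_onD)

text \<open>An orthonormal basis is such a set; only the expansion formula is ever needed.\<close>

definition expansion_basis :: "'e::real_inner set \<Rightarrow> bool" where
  "expansion_basis E \<longleftrightarrow> finite E \<and> (\<forall>x. (\<Sum>b\<in>E. (x \<bullet> b) *\<^sub>R b) = x)"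

lemma expansion_basis_exists:
  fixes B :: "'e::real_inner set"
  assumes "finite B" "span B = UNIV"
  shows "\<exists>E::'e set. expansion_basis E"
proof -
  obtain C :: "'e set" where C: "finite C" "span C = UNIV" "pairwise orthogonal C"
    using basis_orthogonal[OF assms(1)] assms(2) by auto
  \<comment> \<open>Zero is the only vector of \<open>C\<close> that cannot be normalised, and
    removing it does not change the span.\<close>
  define E where "E = (\<lambda>b. inverse (norm b) *\<^sub>R b) ` (C - {0})"
  have "b \<in> span E" if "b \<in> C" for b
  proof (cases "b = 0")
    case False
    then have "norm b *\<^sub>R (inverse (norm b) *\<^sub>R b) \<in> span E"
      using that by (intro span_scale span_base) (auto simp: E_def)
    then show ?thesis using False by simp
  qed (simp add: span_zero)
  then have "span E = UNIV"
    using C(2) span_minimal[of C "span E"] by (auto simp: subspace_span)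
  moreover have "pairwise orthogonal E"
    using C(3) unfolding E_def pairwise_def orthogonal_def by fastforce
  moreover have "finite E" "\<And>i. i \<in> E \<Longrightarrow> norm i = 1"
    using C(1) by (auto simp: E_def field_simps split: if_splits)
  ultimately show ?thesis
    unfolding expansion_basis_def by (metis UNIV_I orthonormal_basis_expand)
qed

lemma expansion_basis_real: "expansion_basis {1::real}"
  by (simp add: expansion_basis_def)

lemma linear_expansion:
  assumes "expansion_basis E" "linear h"
  shows "h v = (\<Sum>b\<in>E. (v \<bullet> b) *\<^sub>R h b)"
proof -
  have "h v = h (\<Sum>b\<in>E. (v \<bullet> b) *\<^sub>R b)"
    using assms(1) by (simp add: expansion_basis_def)
  then show ?thesis
    by (simp add: linear_sum[OF assms(2)] linear_scale[OF assms(2)])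
qed

text \<open>In the chain rule the derivative of \<open>f\<close> is applied to a vector that moves
  with x, whereas \<open>Ck_on\<close> controls derivatives in fixed directions only. Expanding the
  moving vector in \<open>E\<close> leaves finitely many fixed directions, to which the induction
  hypothesis applies.\<close>

lemma Ck_on_compose:
  fixes g :: "'a::real_normed_vector \<Rightarrow> 'b::real_inner"
  assumes E: "expansion_basis (E :: 'b set)"
    and "open S" "open T" "g ` S \<subseteq> T" "Ck_on k g S" "Ck_on k f T"
  shows "Ck_on k (\<lambda>x. f (g x)) S"
  using assms(5,6)
proof (induction k arbitrary: f)
  case 0
  then show ?case using assms(4) by (auto intro: continuous_on_compose2)
next
  case (Suc k)
  have D: "(g has_derivative frechet_derivative g (at x)) (at x)"
    "(f has_derivative frechet_derivative f (at (g x))) (at (g x))" if "x \<in> S" for x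
    using Suc.prems assms(4) that by (auto simp: frechet_derivative_works)
  show ?case
  proof (rule Ck_on_Suc_derivI[where f' = "\<lambda>x v. \<Sum>b\<in>E. (frechet_derivative g (at x) v \<bullet> b) *\<^sub>R frechet_derivative f (at (g x)) b"])
    fix x assume "x \<in> S"
    have "frechet_derivative f (at (g x)) (frechet_derivative g (at x) v)
        = (\<Sum>b\<in>E. (frechet_derivative g (at x) v \<bullet> b) *\<^sub>R frechet_derivative f (at (g x)) b)" for v
      by (rule linear_expansion[OF E]) (use D(2)[OF \<open>x \<in> S\<close>] in \<open>auto intro: has_derivative_linear\<close>)
    then show "((\<lambda>x. f (g x)) has_derivative (\<lambda>v. \<Sum>b\<in>E. (frechet_derivative g (at x) v \<bullet> b) *\<^sub>R frechet_derivative f (at (g x)) b)) (at x)"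
      using has_derivative_compose[OF D[OF \<open>x \<in> S\<close>]] by simp
  next
    show "Ck_on k (\<lambda>x. \<Sum>b\<in>E. (frechet_derivative g (at x) v \<bullet> b) *\<^sub>R frechet_derivative f (at (g x)) b) S" for v
      using Suc.prems Ck_on_SucD[OF Suc.prems(1)] \<open>open S\<close>
      by (auto intro!: Ck_on_sum Ck_on_bilinear[OF bounded_bilinear_scaleR]
          Ck_on_bilinear[OF bounded_bilinear_inner] Ck_on_const Suc.IH)
  qed fact
qed

lemma smooth_on_compose:
  fixes g :: "'a::real_normed_vector \<Rightarrow> 'b::real_inner"
  assumes "expansion_basis (E :: 'b set)" "smooth_on S g" "smooth_on T f" "open S" "open T" "g ` S \<subseteq> T"
  shows "smooth_on S (\<lambda>x. f (g x))"
  using assms by (auto simp: smooth_on_def intro: Ck_on_compose)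

section \<open>Bump functions\<close>

text \<open>The derivatives of \<open>exp (- 1 / t)\<close>, extended by \<open>0\<close>, are linear combinations of these functions.\<close>

definition flat :: "nat \<Rightarrow> real \<Rightarrow> real" where
  "flat n t = (if t > 0 then inverse t ^ n / exp (inverse t) else 0)"

text \<open>Substituting s = 1/t turns the right-hand limit into that of s^n / exp s at infinity; on
  the left the function is 0.\<close>

lemma flat_tendsto_0: "(flat n \<longlongrightarrow> 0) (at 0)"
proof (rule filterlim_split_at)
  have "((\<lambda>t. inverse t ^ n / exp (inverse t)) \<longlongrightarrow> 0) (at_right (0::real))"
    using filterlim_compose[OF tendsto_power_div_exp_0 filterlim_inverse_at_top_right] .
  then show "(flat n \<longlongrightarrow> 0) (at_right 0)"
    by (rule Lim_transform_eventually) (auto simp: flat_def eventually_at_filter)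
  show "(flat n \<longlongrightarrow> 0) (at_left 0)"
    by (rule Lim_transform_eventually[OF tendsto_const]) (auto simp: flat_def eventually_at_filter)
qed

lemma flat_has_derivative:
  "(flat n has_field_derivative flat (n + 2) t - real n * flat (n + 1) t) (at t)"
proof -
  consider "t > 0" | "t < 0" | "t = 0" by linarith
  then show ?thesis
  proof cases
    case 1
    have "((\<lambda>t. inverse t ^ n / exp (inverse t)) has_field_derivative
       inverse t ^ (n + 2) / exp (inverse t) - real n * (inverse t ^ (n + 1) / exp (inverse t))) (at t)"
      using 1 by (auto intro!: derivative_eq_intros
          simp: field_simps power2_eq_square power_Suc[symmetric] simp del: power_Suc)
         (cases n; simp add: field_simps)
    then have "(flat n has_field_derivative
       inverse t ^ (n + 2) / exp (inverse t) - real n * (inverse t ^ (n + 1) / exp (inverse t))) (at t)"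
      by (rule has_field_derivative_transform_within_open[where S = "{0<..}"]) (use 1 in \<open>auto simp: flat_def\<close>)
    then show ?thesis using 1 by (simp add: flat_def)
  next
    case 2
    have "(flat n has_field_derivative 0) (at t)"
      by (rule has_field_derivative_transform_within_open[where S = "{..<0}" and f = "\<lambda>_. 0"])
         (use 2 in \<open>auto simp: flat_def\<close>)
    then show ?thesis using 2 by (simp add: flat_def)
  next
    case 3
    \<comment> \<open>The difference quotient at 0 is the next function of the family; at
      \<open>y = 0\<close> both sides are 0, since division by 0 yields 0.\<close>
    have "(flat n y - flat n 0) / (y - 0) = flat (n + 1) y" for y
      by (auto simp: flat_def field_simps)
    then have "(flat n has_field_derivative 0) (at 0)"
      using flat_tendsto_0[of "n + 1"] by (simp add: has_field_derivative_iff)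
    then show ?thesis using 3 by (simp add: flat_def)
  qed
qed

text \<open>Derivatives of members are linear combinations of members, so the induction on
  \<open>k\<close> is run for all \<open>n\<close> at once.\<close>

lemma smooth_on_flat: "smooth_on UNIV (flat n)"
proof (rule smooth_onI)
  show "Ck_on k (flat n) UNIV" for k
  proof (induction k arbitrary: n)
    case 0
    show ?case
      by (auto intro!: continuous_at_imp_continuous_on DERIV_isCont flat_has_derivative)
  next
    case (Suc k)
    show ?case
    proof (rule Ck_on_Suc_derivI)
      show "(flat n has_derivative (*) (flat (n + 2) x - real n * flat (n + 1) x)) (at x)" for x
        using flat_has_derivative[of n x] by (simp add: has_field_derivative_def)
      have "Ck_on k (\<lambda>x. (flat (n + 2) x + (- real n) * flat (n + 1) x) * v) UNIV" for v
        by (intro Ck_on_bilinear[OF bounded_bilinear_mult] Ck_on_add Ck_on_const Suc.IH open_UNIV)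
      then show "Ck_on k (\<lambda>x. (flat (n + 2) x - real n * flat (n + 1) x) * v) UNIV" for v
        by simp
    qed auto
  qed
qed

lemma smooth_bump:
  fixes x0 :: "'e::real_inner"
  assumes "r > 0"
  obtains \<rho> :: "'e \<Rightarrow> real" where "smooth_on UNIV \<rho>" "\<rho> x0 > 0" "\<And>x. x \<notin> cball x0 r \<Longrightarrow> \<rho> x = 0"
proof
  \<comment> \<open>\<open>flat 0\<close> is exp(-1/t) for t > 0 and 0 otherwise, so its composite
    with this quadratic function is positive exactly on the open ball.\<close>
  let ?q = "\<lambda>x. r\<^sup>2 - (x - x0) \<bullet> (x - x0)"
  show "smooth_on UNIV (\<lambda>x. flat 0 (?q x))"
    by (rule smooth_on_compose[OF expansion_basis_real _ smooth_on_flat])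
       (auto intro!: smooth_on_diff smooth_on_inner smooth_on_const smooth_on_ident)
  show "flat 0 (?q x0) > 0" using assms by (simp add: flat_def)
  show "flat 0 (?q x) = 0" if "x \<notin> cball x0 r" for x
  proof -
    have "r\<^sup>2 \<le> (norm (x - x0))\<^sup>2"
      using that assms by (intro power_mono) (auto simp: dist_norm norm_minus_commute)
    then show ?thesis by (simp add: flat_def power2_norm_eq_inner)
  qed
qed

text \<open>Adding a vector \<open>e\<close> to \<open>E\<close> makes the set the image of an
  interval times the previous set under the continuous map (s, x) to s e + x. This leads to compact
  balls in the model space.\<close>

lemma compact_box_image:
  assumes "finite E"
  shows "compact {\<Sum>b\<in>E. t b *\<^sub>R b |t. \<forall>b\<in>E. \<bar>t b\<bar> \<le> B (b :: 'a::real_normed_vector)}"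
  using assms
proof (induction E)
  case (insert e E)
  let ?S = "{\<Sum>b\<in>E. t b *\<^sub>R b |t. \<forall>b\<in>E. \<bar>t b\<bar> \<le> B b}"
  have "{\<Sum>b\<in>insert e E. t b *\<^sub>R b |t. \<forall>b\<in>insert e E. \<bar>t b\<bar> \<le> B b}
      = (\<lambda>(s, x). s *\<^sub>R e + x) ` ({- B e..B e} \<times> ?S)" (is "?L = ?R")
  proof
    show "?L \<subseteq> ?R"
    proof clarify
      fix t assume t: "\<forall>b\<in>insert e E. \<bar>t b\<bar> \<le> B b"
      have "(\<Sum>b\<in>insert e E. t b *\<^sub>R b) = (\<lambda>(s, x). s *\<^sub>R e + x) (t e, \<Sum>b\<in>E. t b *\<^sub>R b)"
        using insert.hyps by simp
      moreover have "(t e, \<Sum>b\<in>E. t b *\<^sub>R b) \<in> {- B e..B e} \<times> ?S"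
        using t by (auto simp: abs_le_iff)
      ultimately show "(\<Sum>b\<in>insert e E. t b *\<^sub>R b) \<in> ?R" by (rule image_eqI)
    qed
    show "?R \<subseteq> ?L"
    proof clarsimp
      fix s t assume s: "- B e \<le> s" "s \<le> B e" and t: "\<forall>b\<in>E. \<bar>t b\<bar> \<le> B b"
      \<comment> \<open>Overwriting \<open>t\<close> at \<open>e\<close> leaves the sum over
        \<open>E\<close> unchanged because \<open>e\<close> is not in \<open>E\<close>.\<close>
      have "(\<Sum>b\<in>E. t b *\<^sub>R b) = (\<Sum>b\<in>E. (t(e := s)) b *\<^sub>R b)"
        using insert.hyps by (intro sum.cong) auto
      then show "\<exists>t'. s *\<^sub>R e + (\<Sum>b\<in>E. t b *\<^sub>R b) = (\<Sum>b\<in>insert e E. t' b *\<^sub>R b) \<and> \<bar>t' e\<bar> \<le> B e \<and> (\<forall>b\<in>E. \<bar>t' b\<bar> \<le> B b)"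
        using insert.hyps s t by (intro exI[of _ "t(e := s)"]) (auto simp: abs_le_iff)
    qed
  qed
  moreover have "compact ?R"
    unfolding case_prod_unfold
    by (intro compact_continuous_image compact_Times insert.IH compact_Icc continuous_intros)
  ultimately show ?case by simp
qed simp

text \<open>By Cauchy-Schwarz the coordinates of points of the ball around 0 are bounded, so this
  ball is a closed subset of a compact box; other balls are translates.\<close>

lemma compact_cball_expansion_basis:
  fixes x0 :: "'e::real_inner"
  assumes "expansion_basis (E :: 'e set)"
  shows "compact (cball x0 r)"
proof -
  let ?K = "{\<Sum>b\<in>E. t b *\<^sub>R b |t. \<forall>b\<in>E. \<bar>t b\<bar> \<le> r * norm b}"
  have "cball 0 r \<subseteq> ?K"
  proof
    fix x :: 'e assume "x \<in> cball 0 r"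
    then have "\<bar>x \<bullet> b\<bar> \<le> r * norm b" for b
      using Cauchy_Schwarz_ineq2[of x b] mult_right_mono[of "norm x" r "norm b"] by auto
    then show "x \<in> ?K"
      using assms by (auto simp: expansion_basis_def intro!: exI[of _ "\<lambda>b. x \<bullet> b"])
  qed
  moreover have "compact ?K"
    using compact_box_image assms by (auto simp: expansion_basis_def)
  ultimately have "compact (?K \<inter> cball 0 r)" "?K \<inter> cball 0 r = cball 0 r"
    by (auto intro: compact_Int_closed)
  then have "compact ((+) x0 ` cball 0 r)"
    by (intro compact_continuous_image continuous_intros) simp
  then show ?thesis by (simp add: cball_translation[of x0 0])
qed

section \<open>Charts, tangent and cotangent spaces\<close>

text \<open>Fixing one basis lets all local frames be indexed by the same finite set
  \<open>E\<close>; such a basis exists by the finite spanning set in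
  \<open>smooth_manifold\<close>.\<close>

locale manifold_with_basis =
  fixes M :: "'a topology" and A :: "('a, 'e::real_inner) chart set" and E :: "'e set"
  assumes manifold: "smooth_manifold M A" and E: "expansion_basis E"
begin

lemma atlas: "smooth_atlas M A"
  using manifold by (simp add: smooth_manifold_def)

lemma chart:
  assumes "c \<in> A"
  shows "openin M (fst c)" "open (snd c ` fst c)"
    "homeomorphic_map (subtopology M (fst c)) (top_of_set (snd c ` fst c)) (snd c)"
  using atlas assms by (auto simp: smooth_atlas_def is_chart_def)

lemma chart_subset: "c \<in> A \<Longrightarrow> fst c \<subseteq> topspace M"
  using chart(1) openin_subset by blast

lemma chart_cover: "p \<in> topspace M \<Longrightarrow> \<exists>c\<in>A. p \<in> fst c"
  using atlas by (auto simp: smooth_atlas_def)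

lemma inj_on_chart: "c \<in> A \<Longrightarrow> inj_on (snd c) (fst c)"
  using homeomorphic_imp_injective_map[OF chart(3)] chart_subset by (simp add: Int_absorb1)

lemma chart_inv_chart: "c \<in> A \<Longrightarrow> p \<in> fst c \<Longrightarrow> chart_inv c (snd c p) = p"
  by (simp add: chart_inv_def inj_on_chart)

lemma open_chart_image:
  assumes "c \<in> A" "openin M U" "U \<subseteq> fst c"
  shows "open (snd c ` U)"
proof -
  have "openin (subtopology M (fst c)) U"
    using assms chart(1) by (simp add: openin_open_subtopology)
  then have "openin (top_of_set (snd c ` fst c)) (snd c ` U)"
    using homeomorphic_map_openness_eq[OF chart(3)[OF assms(1)]] by blast
  then show ?thesis
    using chart(2)[OF assms(1)] openin_open_eq by blast
qed

lemma open_overlap: "c \<in> A \<Longrightarrow> d \<in> A \<Longrightarrow> open (snd c ` (fst c \<inter> fst d))"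
  by (intro open_chart_image openin_Int chart(1)) auto

lemma smooth_on_transition:
  "c \<in> A \<Longrightarrow> d \<in> A \<Longrightarrow> smooth_on (snd c ` (fst c \<inter> fst d)) (transition c d)"
  using atlas by (auto simp: smooth_atlas_def)

lemma transition_chart: "c \<in> A \<Longrightarrow> p \<in> fst c \<Longrightarrow> transition c d (snd c p) = snd d p"
  by (simp add: transition_def chart_inv_chart)

abbreviation "dtrans c d p \<equiv> frechet_derivative (transition c d) (at (snd c p))"

lemma differentiable_transition:
  "c \<in> A \<Longrightarrow> d \<in> A \<Longrightarrow> p \<in> fst c \<Longrightarrow> p \<in> fst d \<Longrightarrow> transition c d differentiable (at (snd c p))"
  using smooth_on_differentiable[OF smooth_on_transition] by blast

lemma linear_dtrans:
  "c \<in> A \<Longrightarrow> d \<in> A \<Longrightarrow> p \<in> fst c \<Longrightarrow> p \<in> fst d \<Longrightarrow> linear (dtrans c d p)"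
  by (simp add: differentiable_transition linear_frechet_derivative)

text \<open>The cocycle rule. The composite of the two transition maps equals the third only on the
  triple overlap, but this is open, so the derivatives at \<open>snd c p\<close> agree.\<close>

lemma dtrans_chain:
  assumes "c \<in> A" "d \<in> A" "e \<in> A" "p \<in> fst c" "p \<in> fst d" "p \<in> fst e"
  shows "dtrans d e p (dtrans c d p v) = dtrans c e p v"
proof -
  let ?U = "snd c ` (fst c \<inter> fst d \<inter> fst e)"
  have "frechet_derivative (transition d e \<circ> transition c d) (at (snd c p)) = dtrans d e p \<circ> dtrans c d p"
    using frechet_derivative_compose[of "transition c d" "snd c p" "transition d e"] assms
    by (simp add: differentiable_transition transition_chart)
  moreover have "frechet_derivative (transition d e \<circ> transition c d) (at (snd c p)) = dtrans c e p"
  proof (rule frechet_derivative_transform_within_open)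
    show "transition d e \<circ> transition c d differentiable at (snd c p)"
      using assms by (intro differentiable_chain_at) (simp_all add: differentiable_transition transition_chart)
    show "open ?U"
      using assms by (intro open_chart_image openin_Int chart(1)) auto
  qed (use assms in \<open>auto simp: transition_chart\<close>)
  ultimately show ?thesis by (metis comp_apply)
qed

lemma tangent_spaceI:
  assumes "\<And>c. \<not> (c \<in> A \<and> p \<in> fst c) \<Longrightarrow> v c = 0"
    and "\<And>c d. c \<in> A \<Longrightarrow> d \<in> A \<Longrightarrow> p \<in> fst c \<Longrightarrow> p \<in> fst d \<Longrightarrow> dtrans c d p (v c) = v d"
  shows "v \<in> tangent_space A p"
  unfolding tangent_space_def mem_Collect_eq using assms by (metis IntE)

lemma tangent_spaceD:
  assumes "v \<in> tangent_space A p"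
  shows "\<And>c. \<not> (c \<in> A \<and> p \<in> fst c) \<Longrightarrow> v c = 0"
    and "\<And>c d. c \<in> A \<Longrightarrow> d \<in> A \<Longrightarrow> p \<in> fst c \<Longrightarrow> p \<in> fst d \<Longrightarrow> dtrans c d p (v c) = v d"
  using assms unfolding tangent_space_def mem_Collect_eq by (blast, metis IntI)

lemma tangent_outside:
  assumes "v \<in> tangent_space A p" "p \<notin> topspace M"
  shows "v = 0"
proof
  show "v c = 0 c" for c
    using tangent_spaceD(1)[OF assms(1), of c] assms(2) chart_subset[of c] by auto
qed

lemma tangent_zero: "0 \<in> tangent_space A p"
  by (rule tangent_spaceI) (simp_all add: linear_0[OF linear_dtrans])

lemma tangent_add:
  assumes "v \<in> tangent_space A p" "w \<in> tangent_space A p"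
  shows "v + w \<in> tangent_space A p"
  by (rule tangent_spaceI)
     (simp_all add: linear_add[OF linear_dtrans] assms[THEN tangent_spaceD(1)] assms[THEN tangent_spaceD(2)])

lemma tangent_scale:
  assumes "v \<in> tangent_space A p"
  shows "(\<lambda>c. r *\<^sub>R v c) \<in> tangent_space A p"
  by (rule tangent_spaceI)
     (simp_all add: linear_scale[OF linear_dtrans] tangent_spaceD[OF assms])

lemma tangent_sum:
  "(\<And>i. i \<in> I \<Longrightarrow> w i \<in> tangent_space A p) \<Longrightarrow> (\<lambda>c. \<Sum>i\<in>I. r i *\<^sub>R w i c) \<in> tangent_space A p"
proof (induction I rule: infinite_finite_induct)
  case (insert i I)
  then have "(\<lambda>c. r i *\<^sub>R w i c) + (\<lambda>c. \<Sum>i\<in>I. r i *\<^sub>R w i c) \<in> tangent_space A p"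
    by (intro tangent_add tangent_scale) auto
  then show ?case using insert.hyps by (simp add: plus_fun_def)
qed (use tangent_zero in \<open>auto simp: zero_fun_def\<close>)

text \<open>The compatibility of the components in two charts is precisely the cocycle rule.\<close>

lemma coord_vector_tangent: "c \<in> A \<Longrightarrow> p \<in> fst c \<Longrightarrow> coord_vector A c e p \<in> tangent_space A p"
  by (rule tangent_spaceI) (auto simp: coord_vector_def dtrans_chain)

text \<open>A tangent vector is determined by its component in \<open>c\<close>. Expanding that
  component in \<open>E\<close> and applying the linear map \<open>dtrans c d p\<close> gives the
  component in any chart \<open>d\<close> around p; in all other charts both sides are 0.\<close>

lemma coord_vector_expansion:
  assumes "c \<in> A" "p \<in> fst c" "v \<in> tangent_space A p"
  shows "v = (\<lambda>d. \<Sum>b\<in>E. (v c \<bullet> b) *\<^sub>R coord_vector A c b p d)"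
proof
  fix d
  show "v d = (\<Sum>b\<in>E. (v c \<bullet> b) *\<^sub>R coord_vector A c b p d)"
  proof (cases "d \<in> A \<and> p \<in> fst d")
    case True
    then have "v d = dtrans c d p (v c)"
      using assms tangent_spaceD(2) by metis
    then show ?thesis
      using True linear_expansion[OF E linear_dtrans] assms by (simp add: coord_vector_def)
  next
    case False
    then have "coord_vector A c b p d = 0" for b by (auto simp: coord_vector_def)
    then show ?thesis using tangent_spaceD(1)[OF assms(3) False] by simp
  qed
qed

section \<open>Linear algebra of cotangent vectors\<close>

lemma cotangent_outside: "\<alpha> \<in> cotangent_space A p \<Longrightarrow> v \<notin> tangent_space A p \<Longrightarrow> \<alpha> v = 0"
  by (simp add: cotangent_space_def)

lemma cotangent_add:
  "\<alpha> \<in> cotangent_space A p \<Longrightarrow> v \<in> tangent_space A p \<Longrightarrow> w \<in> tangent_space A p \<Longrightarrow> \<alpha> (v + w) = \<alpha> v + \<alpha> w"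
  by (simp add: cotangent_space_def)

lemma cotangent_scale:
  "\<alpha> \<in> cotangent_space A p \<Longrightarrow> v \<in> tangent_space A p \<Longrightarrow> \<alpha> (\<lambda>c. r *\<^sub>R v c) = r * \<alpha> v"
  by (simp add: cotangent_space_def)

lemma cotangent_zero_arg: "\<alpha> \<in> cotangent_space A p \<Longrightarrow> \<alpha> 0 = 0"
  using cotangent_add[of \<alpha> p 0 0] tangent_zero by simp

lemma cotangent_sum:
  assumes "\<alpha> \<in> cotangent_space A p" "\<And>i. i \<in> I \<Longrightarrow> w i \<in> tangent_space A p"
  shows "\<alpha> (\<lambda>c. \<Sum>i\<in>I. r i *\<^sub>R w i c) = (\<Sum>i\<in>I. r i * \<alpha> (w i))"
  using assms(2)
proof (induction I rule: infinite_finite_induct)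
  case (insert i I)
  have "(\<lambda>c. \<Sum>i\<in>insert i I. r i *\<^sub>R w i c) = (\<lambda>c. r i *\<^sub>R w i c) + (\<lambda>c. \<Sum>i\<in>I. r i *\<^sub>R w i c)"
    using insert.hyps by (simp add: plus_fun_def)
  then show ?case
    using insert assms(1) tangent_sum[of I w p r]
    by (simp add: cotangent_add cotangent_scale tangent_scale)
qed (use cotangent_zero_arg[OF assms(1)] in \<open>auto simp: zero_fun_def\<close>)

lemma cotangent_expansion:
  assumes "c \<in> A" "p \<in> fst c" "v \<in> tangent_space A p" "\<alpha> \<in> cotangent_space A p"
  shows "\<alpha> v = (\<Sum>b\<in>E. (v c \<bullet> b) * \<alpha> (coord_vector A c b p))"
  using coord_vector_expansion[OF assms(1-3)]
    cotangent_sum[OF assms(4), of E "\<lambda>b. coord_vector A c b p" "\<lambda>b. v c \<bullet> b"]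
    coord_vector_tangent[OF assms(1,2)] by simp

lemma cotangent_space_add:
  "\<alpha> \<in> cotangent_space A p \<Longrightarrow> \<beta> \<in> cotangent_space A p \<Longrightarrow> \<alpha> + \<beta> \<in> cotangent_space A p"
  by (simp add: cotangent_space_def algebra_simps)

lemma cotangent_space_scale:
  "\<alpha> \<in> cotangent_space A p \<Longrightarrow> (\<lambda>v. r *\<^sub>R \<alpha> v) \<in> cotangent_space A p"
  by (simp add: cotangent_space_def algebra_simps)

lemma cotangent_space_zero: "0 \<in> cotangent_space A p"
  by (simp add: cotangent_space_def)

lemma cotangent_space_sum:
  "(\<And>i. i \<in> I \<Longrightarrow> \<theta> i \<in> cotangent_space A p) \<Longrightarrow> (\<lambda>v. \<Sum>i\<in>I. r i *\<^sub>R \<theta> i v) \<in> cotangent_space A p"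
proof (induction I rule: infinite_finite_induct)
  case (insert i I)
  then have "(\<lambda>v. r i *\<^sub>R \<theta> i v) + (\<lambda>v. \<Sum>i\<in>I. r i *\<^sub>R \<theta> i v) \<in> cotangent_space A p"
    by (intro cotangent_space_add cotangent_space_scale) auto
  then show ?case using insert.hyps by (simp add: plus_fun_def)
qed (use cotangent_space_zero in \<open>auto simp: zero_fun_def\<close>)

section \<open>Smooth sections\<close>

abbreviation "\<F> \<equiv> smooth_functions M A"
abbreviation "\<X> \<equiv> vector_fields A"
abbreviation "\<Omega> \<equiv> one_forms A"

lemma smooth_functionsI:
  "(\<And>p. p \<notin> topspace M \<Longrightarrow> f p = 0) \<Longrightarrow>
   (\<And>c. c \<in> A \<Longrightarrow> smooth_on (snd c ` fst c) (\<lambda>x. f (chart_inv c x))) \<Longrightarrow> f \<in> \<F>"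
  by (simp add: smooth_functions_def o_def)

lemma smooth_functionsD:
  "f \<in> \<F> \<Longrightarrow> c \<in> A \<Longrightarrow> smooth_on (snd c ` fst c) (\<lambda>x. f (chart_inv c x))"
  by (simp add: smooth_functions_def o_def)

lemma smooth_functions_outside: "f \<in> \<F> \<Longrightarrow> p \<notin> topspace M \<Longrightarrow> f p = 0"
  by (simp add: smooth_functions_def)

lemma vector_fieldsI:
  "(\<And>p. X p \<in> tangent_space A p) \<Longrightarrow>
   (\<And>c. c \<in> A \<Longrightarrow> smooth_on (snd c ` fst c) (\<lambda>x. X (chart_inv c x) c)) \<Longrightarrow> X \<in> \<X>"
  by (simp add: vector_fields_def)

lemma vector_fieldsD:
  "X \<in> \<X> \<Longrightarrow> X p \<in> tangent_space A p"
  "X \<in> \<X> \<Longrightarrow> c \<in> A \<Longrightarrow> smooth_on (snd c ` fst c) (\<lambda>x. X (chart_inv c x) c)"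
  by (simp_all add: vector_fields_def)

lemma one_formsI:
  "(\<And>p. \<xi> p \<in> cotangent_space A p) \<Longrightarrow>
   (\<And>c e. c \<in> A \<Longrightarrow> smooth_on (snd c ` fst c)
      (\<lambda>x. \<xi> (chart_inv c x) (coord_vector A c e (chart_inv c x)))) \<Longrightarrow> \<xi> \<in> \<Omega>"
  by (simp add: one_forms_def)

lemma one_formsD:
  "\<xi> \<in> \<Omega> \<Longrightarrow> \<xi> p \<in> cotangent_space A p"
  "\<xi> \<in> \<Omega> \<Longrightarrow> c \<in> A \<Longrightarrow> smooth_on (snd c ` fst c)
      (\<lambda>x. \<xi> (chart_inv c x) (coord_vector A c e (chart_inv c x)))"
  by (simp_all add: one_forms_def)

section \<open>Module operations on functions, fields and forms\<close>

lemma smooth_functions_zero: "0 \<in> \<F>"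
  by (rule smooth_functionsI) (simp_all add: smooth_on_const)

lemma smooth_functions_add: "f \<in> \<F> \<Longrightarrow> g \<in> \<F> \<Longrightarrow> f + g \<in> \<F>"
  by (rule smooth_functionsI)
     (simp_all add: smooth_functions_outside smooth_on_add smooth_functionsD chart(2))

lemma smooth_functions_mult: "f \<in> \<F> \<Longrightarrow> g \<in> \<F> \<Longrightarrow> f * g \<in> \<F>"
  by (rule smooth_functionsI)
     (simp_all add: smooth_functions_outside smooth_on_mult smooth_functionsD chart(2))

lemma smooth_functions_cmult: "f \<in> \<F> \<Longrightarrow> (\<lambda>p. r * f p) \<in> \<F>"
  by (rule smooth_functionsI)
     (simp_all add: smooth_functions_outside smooth_on_mult smooth_on_const smooth_functionsD chart(2))

lemma vector_fields_zero: "0 \<in> \<X>"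
  by (rule vector_fieldsI) (simp_all add: tangent_zero smooth_on_const)

lemma vector_fields_add: "X \<in> \<X> \<Longrightarrow> Y \<in> \<X> \<Longrightarrow> X + Y \<in> \<X>"
  by (rule vector_fieldsI) (simp_all add: tangent_add smooth_on_add vector_fieldsD chart(2))

lemma vector_fields_fscale: "f \<in> \<F> \<Longrightarrow> X \<in> \<X> \<Longrightarrow> fscale f X \<in> \<X>"
  by (rule vector_fieldsI)
     (simp_all add: fscale_def tangent_scale smooth_on_scaleR vector_fieldsD smooth_functionsD chart(2))

lemma one_forms_zero: "0 \<in> \<Omega>"
  by (rule one_formsI) (simp_all add: cotangent_space_zero smooth_on_const)

lemma one_forms_add: "\<xi> \<in> \<Omega> \<Longrightarrow> \<eta> \<in> \<Omega> \<Longrightarrow> \<xi> + \<eta> \<in> \<Omega>"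
  by (rule one_formsI) (simp_all add: cotangent_space_add smooth_on_add one_formsD chart(2))

lemma one_forms_fscale: "f \<in> \<F> \<Longrightarrow> \<xi> \<in> \<Omega> \<Longrightarrow> fscale f \<xi> \<in> \<Omega>"
  using cotangent_space_scale
  by (intro one_formsI)
     (simp_all add: fscale_def smooth_on_mult one_formsD smooth_functionsD chart(2))

text \<open>In a chart the pairing is a finite sum of products of components, and these are smooth
  by definition of fields and forms.\<close>

lemma pairing_smooth:
  assumes "\<xi> \<in> \<Omega>" "X \<in> \<X>"
  shows "pairing \<xi> X \<in> \<F>"
proof (rule smooth_functionsI)
  show "pairing \<xi> X p = 0" if "p \<notin> topspace M" for p
    using tangent_outside[OF vector_fieldsD(1)[OF assms(2)] that]
      cotangent_zero_arg[OF one_formsD(1)[OF assms(1)]] by (simp add: pairing_def)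
next
  fix c assume c: "c \<in> A"
  have "smooth_on (snd c ` fst c) (\<lambda>x. \<Sum>b\<in>E. (X (chart_inv c x) c \<bullet> b) *
      \<xi> (chart_inv c x) (coord_vector A c b (chart_inv c x)))"
    using assms c chart(2)[OF c]
    by (intro smooth_on_sum smooth_on_mult smooth_on_inner smooth_on_const vector_fieldsD one_formsD)
  then show "smooth_on (snd c ` fst c) (\<lambda>x. pairing \<xi> X (chart_inv c x))"
  proof (rule smooth_on_cong[OF _ chart(2)[OF c]])
    fix x assume "x \<in> snd c ` fst c"
    then have "chart_inv c x \<in> fst c" using c by (auto simp: chart_inv_chart)
    then show "(\<Sum>b\<in>E. (X (chart_inv c x) c \<bullet> b) * \<xi> (chart_inv c x) (coord_vector A c b (chart_inv c x)))
        = pairing \<xi> X (chart_inv c x)"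
      unfolding pairing_def
      by (rule cotangent_expansion[OF c _ vector_fieldsD(1)[OF assms(2)] one_formsD(1)[OF assms(1)], symmetric])
  qed
qed

text \<open>Near q the function \<open>f\<close> has no zero, so \<open>g\<close> is recovered there
  as the product of 1/f with the smooth map f g; smoothness is local.\<close>

lemma smooth_on_division:
  fixes g :: "'e \<Rightarrow> 'f::real_normed_vector"
  assumes c: "c \<in> A"
    and "\<And>q. q \<in> fst c \<Longrightarrow> \<exists>f\<in>\<F>. f q \<noteq> 0 \<and> smooth_on (snd c ` fst c) (\<lambda>x. f (chart_inv c x) *\<^sub>R g x)"
  shows "smooth_on (snd c ` fst c) g"
proof (rule smooth_on_locally, clarify)
  fix q assume q: "q \<in> fst c"
  then obtain f where f: "f \<in> \<F>" "f q \<noteq> 0" "smooth_on (snd c ` fst c) (\<lambda>x. f (chart_inv c x) *\<^sub>R g x)"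
    using assms(2) by blast
  let ?f = "\<lambda>x. f (chart_inv c x)"
  \<comment> \<open>The neighbourhood on which division is possible; it is open because
    \<open>f\<close> is continuous in the chart and the chart image is open.\<close>
  define T where "T = {x \<in> snd c ` fst c. ?f x \<noteq> 0}"
  have "continuous_on (snd c ` fst c) ?f"
    using smooth_onD[OF smooth_functionsD[OF f(1) c], of 0] by simp
  then have "openin (top_of_set (snd c ` fst c)) ((snd c ` fst c) \<inter> ?f -` (- {0}))"
    by (rule continuous_openin_preimage_gen) auto
  moreover have "(snd c ` fst c) \<inter> ?f -` (- {0}) = T" by (auto simp: T_def)
  ultimately have T: "open T" "T \<subseteq> snd c ` fst c"
    using openin_open_eq[OF chart(2)[OF c]] by auto
  have "smooth_on T (\<lambda>x. inverse (?f x) *\<^sub>R (?f x *\<^sub>R g x))"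
    using T by (intro smooth_on_scaleR smooth_on_inverse smooth_on_subset[OF f(3)]
        smooth_on_subset[OF smooth_functionsD[OF f(1) c]]) (auto simp: T_def)
  then have "smooth_on T g"
    by (rule smooth_on_cong[OF _ T(1)]) (simp add: T_def)
  moreover have "snd c q \<in> T"
    using q f(2) c by (auto simp: T_def chart_inv_chart)
  ultimately show "\<exists>T. open T \<and> snd c q \<in> T \<and> smooth_on T g"
    using T(1) by blast
qed

text \<open>Takes the place of a partition of unity: a field assembled point by point is smooth as
  soon as each point has a multiplier, nonzero there, that makes it a smooth field.\<close>

lemma vector_field_division:
  assumes "\<And>p. X p \<in> tangent_space A p"
    and "\<And>q. q \<in> topspace M \<Longrightarrow> \<exists>f\<in>\<F>. f q \<noteq> 0 \<and> fscale f X \<in> \<X>"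
  shows "X \<in> \<X>"
proof (rule vector_fieldsI[OF assms(1)])
  fix c assume c: "c \<in> A"
  show "smooth_on (snd c ` fst c) (\<lambda>x. X (chart_inv c x) c)"
  proof (rule smooth_on_division[OF c])
    fix q assume "q \<in> fst c"
    then obtain f where f: "f \<in> \<F>" "f q \<noteq> 0" "fscale f X \<in> \<X>"
      using assms(2) chart_subset[OF c] by blast
    then show "\<exists>f\<in>\<F>. f q \<noteq> 0 \<and> smooth_on (snd c ` fst c) (\<lambda>x. f (chart_inv c x) *\<^sub>R X (chart_inv c x) c)"
      using vector_fieldsD(2)[OF f(3) c] by (auto simp: fscale_def)
  qed
qed

lemma one_form_division:
  assumes "\<And>p. \<xi> p \<in> cotangent_space A p"
    and "\<And>q. q \<in> topspace M \<Longrightarrow> \<exists>f\<in>\<F>. f q \<noteq> 0 \<and> fscale f \<xi> \<in> \<Omega>"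
  shows "\<xi> \<in> \<Omega>"
proof (rule one_formsI[OF assms(1)])
  fix c e assume c: "c \<in> A"
  show "smooth_on (snd c ` fst c) (\<lambda>x. \<xi> (chart_inv c x) (coord_vector A c e (chart_inv c x)))"
  proof (rule smooth_on_division[OF c])
    fix q assume "q \<in> fst c"
    then obtain f where f: "f \<in> \<F>" "f q \<noteq> 0" "fscale f \<xi> \<in> \<Omega>"
      using assms(2) chart_subset[OF c] by blast
    then show "\<exists>f\<in>\<F>. f q \<noteq> 0 \<and> smooth_on (snd c ` fst c)
        (\<lambda>x. f (chart_inv c x) *\<^sub>R \<xi> (chart_inv c x) (coord_vector A c e (chart_inv c x)))"
      using one_formsD(2)[OF f(3) c, of e] by (auto simp: fscale_def)
  qed
qed

section \<open>Local frames\<close>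

text \<open>The domain of \<open>d\<close> is covered by two open sets: the overlap with
  \<open>c\<close>, and the complement of the closed set \<open>K\<close>, where \<open>g\<close>
  vanishes. Smoothness is checked on each.\<close>

lemma smooth_on_extend_zero:
  assumes "c \<in> A" "d \<in> A" "closedin M K" "K \<subseteq> fst c"
    and "smooth_on (snd d ` (fst d \<inter> fst c)) g"
    and "\<And>p. p \<in> fst d \<Longrightarrow> p \<notin> K \<Longrightarrow> g (snd d p) = 0"
  shows "smooth_on (snd d ` fst d) g"
proof (rule smooth_on_locally, clarify)
  fix p assume p: "p \<in> fst d"
  show "\<exists>T. open T \<and> snd d p \<in> T \<and> smooth_on T g"
  proof (cases "p \<in> K")
    case True
    then show ?thesis using assms open_overlap[OF assms(2,1)] p by blast
  next
    case False
    have "open (snd d ` (fst d - K))"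
      using assms chart(1) by (intro open_chart_image openin_diff) auto
    moreover have "smooth_on (snd d ` (fst d - K)) g"
      by (rule smooth_on_cong[OF smooth_on_const[where c = 0]]) (use assms calculation in auto)
    ultimately show ?thesis using False p by blast
  qed
qed

text \<open>The Euclidean bump is pulled back along \<open>c\<close>. Its ball lies inside the chart
  image, so the preimage \<open>K\<close> of the ball is compact by the homeomorphism
  property.\<close>

lemma bump_function:
  assumes c: "c \<in> A" and p0: "p0 \<in> fst c"
  obtains \<psi> K where "\<psi> \<in> \<F>" "\<psi> p0 \<noteq> 0" "closedin M K" "K \<subseteq> fst c" "\<And>p. p \<notin> K \<Longrightarrow> \<psi> p = 0"
proof -
  obtain r where r: "r > 0" "cball (snd c p0) r \<subseteq> snd c ` fst c"
    using chart(2)[OF c] p0 open_contains_cball by blast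
  obtain \<rho> :: "'e \<Rightarrow> real" where \<rho>: "smooth_on UNIV \<rho>" "\<rho> (snd c p0) > 0"
    "\<And>x. x \<notin> cball (snd c p0) r \<Longrightarrow> \<rho> x = 0"
    using smooth_bump[OF r(1)] by blast
  define K where "K = {p \<in> fst c. snd c p \<in> cball (snd c p0) r}"
  define \<psi> where "\<psi> p = (if p \<in> fst c then \<rho> (snd c p) else 0)" for p
  have "snd c ` K = cball (snd c p0) r"
    using r(2) by (fastforce simp: K_def)
  then have "compactin (top_of_set (snd c ` fst c)) (snd c ` K)"
    using compact_cball_expansion_basis[OF E] r(2) by (simp add: compactin_subtopology)
  then have "compactin (subtopology M (fst c)) K"
    using homeomorphic_map_compactness[OF chart(3)[OF c], of K] chart_subset[OF c] by (auto simp: K_def)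
  then have "compactin M K" by (simp add: compactin_subtopology)
  \<comment> \<open>Here the Hausdorff property enters; closedness of \<open>K\<close> is what
    permits smooth extension by 0.\<close>
  then have K: "closedin M K"
    using manifold compactin_imp_closedin by (auto simp: smooth_manifold_def)
  have KU: "K \<subseteq> fst c" by (auto simp: K_def)
  have \<psi>0: "\<psi> p = 0" if "p \<notin> K" for p
    using that \<rho>(3) by (auto simp: \<psi>_def K_def)
  have "\<psi> \<in> \<F>"
  proof (rule smooth_functionsI)
    show "\<psi> p = 0" if "p \<notin> topspace M" for p
      using that chart_subset[OF c] by (auto simp: \<psi>_def)
    fix d assume d: "d \<in> A"
    show "smooth_on (snd d ` fst d) (\<lambda>x. \<psi> (chart_inv d x))"
    proof (rule smooth_on_extend_zero[OF c d K KU])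
      have "smooth_on (snd d ` (fst d \<inter> fst c)) (\<lambda>x. \<rho> (transition d c x))"
        by (rule smooth_on_compose[OF E smooth_on_transition[OF d c] \<rho>(1) open_overlap[OF d c]]) auto
      then show "smooth_on (snd d ` (fst d \<inter> fst c)) (\<lambda>x. \<psi> (chart_inv d x))"
        by (rule smooth_on_cong[OF _ open_overlap[OF d c]])
           (auto simp: \<psi>_def chart_inv_chart[OF d] transition_chart[OF d])
    qed (simp add: \<psi>0 chart_inv_chart[OF d])
  qed
  moreover have "\<psi> p0 \<noteq> 0" using \<rho>(2) p0 by (simp add: \<psi>_def)
  ultimately show thesis using that K KU \<psi>0 by blast
qed

lemma frame_field:
  assumes c: "c \<in> A" and \<psi>: "\<psi> \<in> \<F>" and K: "closedin M K" "K \<subseteq> fst c" "\<And>p. p \<notin> K \<Longrightarrow> \<psi> p = 0"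
  shows "fscale \<psi> (coord_vector A c b) \<in> \<X>"
proof (rule vector_fieldsI)
  show "fscale \<psi> (coord_vector A c b) p \<in> tangent_space A p" for p
  proof (cases "p \<in> fst c")
    case True
    then show ?thesis using c by (simp add: fscale_def tangent_scale coord_vector_tangent)
  next
    case False
    then have "\<psi> p = 0" using K by blast
    then show ?thesis using tangent_zero[of p] by (simp add: fscale_def zero_fun_def)
  qed
  fix d assume d: "d \<in> A"
  show "smooth_on (snd d ` fst d) (\<lambda>x. fscale \<psi> (coord_vector A c b) (chart_inv d x) d)"
  proof (rule smooth_on_extend_zero[OF c d K(1,2)])
    \<comment> \<open>The component in \<open>d\<close> is a derivative of
      \<open>transition c d\<close> taken at the c-coordinates of the point. Written in
      d-coordinates this base point is \<open>transition d c x\<close>, so a composition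
      appears.\<close>
    have "smooth_on (snd d ` (fst d \<inter> fst c)) (\<lambda>x. frechet_derivative (transition c d) (at (transition d c x)) b)"
      by (rule smooth_on_compose[OF E smooth_on_transition[OF d c] smooth_on_derivative[OF smooth_on_transition[OF c d]]
            open_overlap[OF d c] open_overlap[OF c d]])
         (auto simp: transition_chart[OF d])
    then have "smooth_on (snd d ` (fst d \<inter> fst c))
       (\<lambda>x. \<psi> (chart_inv d x) *\<^sub>R frechet_derivative (transition c d) (at (transition d c x)) b)"
      by (intro smooth_on_scaleR open_overlap[OF d c] smooth_on_subset[OF smooth_functionsD[OF \<psi> d]]) auto
    then show "smooth_on (snd d ` (fst d \<inter> fst c)) (\<lambda>x. fscale \<psi> (coord_vector A c b) (chart_inv d x) d)"
      by (rule smooth_on_cong[OF _ open_overlap[OF d c]])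
         (auto simp: fscale_def coord_vector_def d chart_inv_chart[OF d] transition_chart[OF d])
  qed (simp add: K(3) fscale_def chart_inv_chart[OF d])
qed

text \<open>The differential of the coordinate \<open>p \<mapsto> snd c p \<bullet> b\<close>.\<close>

definition coord_form :: "('a, 'e) chart \<Rightarrow> 'e \<Rightarrow> ('a, 'e) oneform" where
  "coord_form c b p v = (if v \<in> tangent_space A p then v c \<bullet> b else 0)"

lemma coord_form_cotangent: "coord_form c b p \<in> cotangent_space A p"
  by (simp add: cotangent_space_def coord_form_def tangent_add tangent_scale inner_add_left)

text \<open>On the coordinate vectors of another chart \<open>d\<close>, the form is \<psi> times
  the inner product of \<open>b\<close> with a directional derivative of
  \<open>transition d c\<close>, hence smooth on the overlap; it vanishes off
  \<open>K\<close>.\<close>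

lemma coframe_form:
  assumes c: "c \<in> A" and \<psi>: "\<psi> \<in> \<F>" and K: "closedin M K" "K \<subseteq> fst c" "\<And>p. p \<notin> K \<Longrightarrow> \<psi> p = 0"
  shows "fscale \<psi> (coord_form c b) \<in> \<Omega>"
proof (rule one_formsI)
  show "fscale \<psi> (coord_form c b) p \<in> cotangent_space A p" for p
    unfolding fscale_def by (rule cotangent_space_scale[OF coord_form_cotangent])
  fix d e assume d: "d \<in> A"
  show "smooth_on (snd d ` fst d) (\<lambda>x. fscale \<psi> (coord_form c b) (chart_inv d x) (coord_vector A d e (chart_inv d x)))"
  proof (rule smooth_on_extend_zero[OF c d K(1,2)])
    have "smooth_on (snd d ` (fst d \<inter> fst c))
       (\<lambda>x. \<psi> (chart_inv d x) * (frechet_derivative (transition d c) (at x) e \<bullet> b))"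
      by (intro smooth_on_mult smooth_on_inner smooth_on_const smooth_on_derivative smooth_on_transition[OF d c]
          open_overlap[OF d c] smooth_on_subset[OF smooth_functionsD[OF \<psi> d]]) auto
    then show "smooth_on (snd d ` (fst d \<inter> fst c))
       (\<lambda>x. fscale \<psi> (coord_form c b) (chart_inv d x) (coord_vector A d e (chart_inv d x)))"
    proof (rule smooth_on_cong[OF _ open_overlap[OF d c]], clarify)
      fix p assume p: "p \<in> fst d" "p \<in> fst c"
      then have "coord_vector A d e p c = dtrans d c p e" using c by (simp add: coord_vector_def)
      then show "\<psi> (chart_inv d (snd d p)) * (dtrans d c p e \<bullet> b)
          = fscale \<psi> (coord_form c b) (chart_inv d (snd d p)) (coord_vector A d e (chart_inv d (snd d p)))"
        using p by (simp add: fscale_def coord_form_def coord_vector_tangent[OF d] chart_inv_chart[OF d])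
    qed
  qed (simp add: K(3) fscale_def chart_inv_chart[OF d])
qed

lemma local_frame:
  assumes "q \<in> topspace M"
  obtains f X \<theta> where "f \<in> \<F>" "f q \<noteq> 0" "\<And>b. X b \<in> \<X>" "\<And>b. \<theta> b \<in> \<Omega>"
    "\<And>p v. v \<in> tangent_space A p \<Longrightarrow> (\<lambda>c. f p *\<^sub>R v c) = (\<lambda>c. \<Sum>b\<in>E. \<theta> b p v *\<^sub>R X b p c)"
    "\<And>p \<alpha>. \<alpha> \<in> cotangent_space A p \<Longrightarrow> (\<lambda>v. f p *\<^sub>R \<alpha> v) = (\<lambda>v. \<Sum>b\<in>E. \<alpha> (X b p) *\<^sub>R \<theta> b p v)"
proof -
  obtain c where c: "c \<in> A" "q \<in> fst c" using chart_cover assms by blast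
  obtain \<psi> K where \<psi>: "\<psi> \<in> \<F>" "\<psi> q \<noteq> 0" "closedin M K" "K \<subseteq> fst c" "\<And>p. p \<notin> K \<Longrightarrow> \<psi> p = 0"
    using bump_function[OF c] by blast
  let ?X = "\<lambda>b. fscale \<psi> (coord_vector A c b)" and ?\<theta> = "\<lambda>b. fscale \<psi> (coord_form c b)"
  have v: "((\<psi> * \<psi>) p) *\<^sub>R v d = (\<Sum>b\<in>E. ?\<theta> b p v *\<^sub>R ?X b p d)"
    if v: "v \<in> tangent_space A p" for p v d
  proof (cases "p \<in> fst c")
    case True
    have "v d = (\<Sum>b\<in>E. (v c \<bullet> b) *\<^sub>R coord_vector A c b p d)"
      using fun_cong[OF coord_vector_expansion[OF c(1) True v]] .
    then have "((\<psi> * \<psi>) p) *\<^sub>R v d = ((\<psi> * \<psi>) p) *\<^sub>R (\<Sum>b\<in>E. (v c \<bullet> b) *\<^sub>R coord_vector A c b p d)"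
      by (rule arg_cong)
    also have "\<dots> = (\<Sum>b\<in>E. ?\<theta> b p v *\<^sub>R ?X b p d)"
      by (simp add: scaleR_sum_right fscale_def coord_form_def v mult_ac)
    finally show ?thesis .
  next
    case False
    then have "\<psi> p = 0" using \<psi> by blast
    then show ?thesis by (simp add: fscale_def)
  qed
  have \<alpha>: "((\<psi> * \<psi>) p) *\<^sub>R \<alpha> v = (\<Sum>b\<in>E. \<alpha> (?X b p) *\<^sub>R ?\<theta> b p v)"
    if \<alpha>: "\<alpha> \<in> cotangent_space A p" for p v \<alpha>
  proof (cases "p \<in> fst c \<and> v \<in> tangent_space A p")
    case True
    then have "((\<psi> * \<psi>) p) *\<^sub>R \<alpha> v = ((\<psi> * \<psi>) p) * (\<Sum>b\<in>E. (v c \<bullet> b) * \<alpha> (coord_vector A c b p))"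
      using cotangent_expansion[OF c(1) _ _ \<alpha>] by simp
    also have "\<dots> = (\<Sum>b\<in>E. \<alpha> (?X b p) *\<^sub>R ?\<theta> b p v)"
      using True by (simp add: sum_distrib_left fscale_def coord_form_def mult_ac
          cotangent_scale[OF \<alpha> coord_vector_tangent[OF c(1)]])
    finally show ?thesis .
  next
    case False
    \<comment> \<open>Covectors are normalised to 0 off the tangent space, so arguments that are not
      tangent vectors are covered too.\<close>
    then have "\<psi> p = 0 \<or> v \<notin> tangent_space A p" using \<psi>(4,5) by blast
    then show ?thesis
      using cotangent_outside[OF \<alpha>] by (auto simp: fscale_def coord_form_def)
  qed
  show thesis
    by (rule that[of "\<psi> * \<psi>" ?X ?\<theta>])
       (use \<psi> v \<alpha> frame_field[OF c(1) \<psi>(1,3-5)] coframe_form[OF c(1) \<psi>(1,3-5)]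
         in \<open>simp_all add: smooth_functions_mult\<close>)
qed

section \<open>Duality between vector fields and 1-forms\<close>

lemma vector_fields_uminus: "X \<in> \<X> \<Longrightarrow> - X \<in> \<X>"
  using tangent_scale[of "X _" _ "-1"]
  by (intro vector_fieldsI) (simp_all add: fun_Compl_def vector_fieldsD smooth_on_minus chart(2))

lemma one_forms_uminus: "\<xi> \<in> \<Omega> \<Longrightarrow> - \<xi> \<in> \<Omega>"
  using cotangent_space_scale[of "\<xi> _" _ "-1"]
  by (intro one_formsI) (simp_all add: fun_Compl_def one_formsD smooth_on_minus chart(2))

lemma vector_fields_combination:
  assumes "\<And>i. i \<in> I \<Longrightarrow> g i \<in> \<F>" "\<And>i. i \<in> I \<Longrightarrow> X i \<in> \<X>"
  shows "(\<lambda>p c. \<Sum>i\<in>I. g i p *\<^sub>R X i p c) \<in> \<X>"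
proof (rule vector_fieldsI)
  show "(\<lambda>c. \<Sum>i\<in>I. g i p *\<^sub>R X i p c) \<in> tangent_space A p" for p
    using assms by (intro tangent_sum vector_fieldsD)
  show "smooth_on (snd c ` fst c) (\<lambda>x. \<Sum>i\<in>I. g i (chart_inv c x) *\<^sub>R X i (chart_inv c x) c)"
    if "c \<in> A" for c
    using assms that by (intro smooth_on_sum smooth_on_scaleR vector_fieldsD smooth_functionsD chart(2))
qed

lemma one_forms_combination:
  assumes "\<And>i. i \<in> I \<Longrightarrow> g i \<in> \<F>" "\<And>i. i \<in> I \<Longrightarrow> \<xi> i \<in> \<Omega>"
  shows "(\<lambda>p v. \<Sum>i\<in>I. g i p *\<^sub>R \<xi> i p v) \<in> \<Omega>"
proof (rule one_formsI)
  show "(\<lambda>v. \<Sum>i\<in>I. g i p *\<^sub>R \<xi> i p v) \<in> cotangent_space A p" for p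
    using assms by (intro cotangent_space_sum one_formsD)
  show "smooth_on (snd c ` fst c) (\<lambda>x. \<Sum>i\<in>I. g i (chart_inv c x) *\<^sub>R
      \<xi> i (chart_inv c x) (coord_vector A c e (chart_inv c x)))"
    if "c \<in> A" for c e
    using assms that by (intro smooth_on_sum smooth_on_scaleR one_formsD smooth_functionsD chart(2))
qed

text \<open>By the frame identity the values of the forms on a vector determine its multiple by
  \<open>f p\<close>, and \<open>f p\<close> can be cancelled.\<close>

lemma tangent_eqI:
  assumes "v \<in> tangent_space A p" "w \<in> tangent_space A p" "\<And>\<xi>. \<xi> \<in> \<Omega> \<Longrightarrow> \<xi> p v = \<xi> p w"
  shows "v = w"
proof (cases "p \<in> topspace M")
  case True
  then show ?thesis
  proof (rule local_frame)
    fix f X \<theta>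
    assume "f p \<noteq> 0" and \<theta>: "\<And>b. \<theta> b \<in> \<Omega>"
      and frame: "\<And>p v. v \<in> tangent_space A p \<Longrightarrow> (\<lambda>c. f p *\<^sub>R v c) = (\<lambda>c. \<Sum>b\<in>E. \<theta> b p v *\<^sub>R X b p c)"
    have "(\<lambda>c. f p *\<^sub>R v c) = (\<lambda>c. f p *\<^sub>R w c)"
      unfolding frame[OF assms(1)] frame[OF assms(2)] by (simp add: assms(3)[OF \<theta>])
    then show ?thesis using \<open>f p \<noteq> 0\<close> by (auto simp: fun_eq_iff)
  qed
next
  case False
  then show ?thesis using assms tangent_outside by metis
qed

text \<open>Dual to \<open>tangent_eqI\<close>: the frame recovers a covector from its values on the
  fields. Off the manifold the only tangent vector is 0.\<close>

lemma cotangent_eqI: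
  assumes "\<alpha> \<in> cotangent_space A p" "\<beta> \<in> cotangent_space A p" "\<And>X. X \<in> \<X> \<Longrightarrow> \<alpha> (X p) = \<beta> (X p)"
  shows "\<alpha> = \<beta>"
proof (cases "p \<in> topspace M")
  case True
  then show ?thesis
  proof (rule local_frame)
    fix f X \<theta>
    assume "f p \<noteq> 0" and X: "\<And>b. X b \<in> \<X>"
      and frame: "\<And>p \<alpha>. \<alpha> \<in> cotangent_space A p \<Longrightarrow> (\<lambda>v. f p *\<^sub>R \<alpha> v) = (\<lambda>v. \<Sum>b\<in>E. \<alpha> (X b p) *\<^sub>R \<theta> b p v)"
    have "(\<lambda>v. f p *\<^sub>R \<alpha> v) = (\<lambda>v. f p *\<^sub>R \<beta> v)"
      unfolding frame[OF assms(1)] frame[OF assms(2)] by (simp add: assms(3)[OF X])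
    then show ?thesis using \<open>f p \<noteq> 0\<close> by (auto simp: fun_eq_iff)
  qed
next
  case False
  have "\<alpha> v = \<beta> v" for v
    using tangent_outside[OF _ False, of v] assms(1,2)
    by (cases "v \<in> tangent_space A p") (auto simp: cotangent_outside cotangent_zero_arg)
  then show ?thesis by blast
qed

lemma vector_field_eqI:
  assumes "X \<in> \<X>" "Y \<in> \<X>" "\<And>\<xi>. \<xi> \<in> \<Omega> \<Longrightarrow> pairing \<xi> X = pairing \<xi> Y"
  shows "X = Y"
proof
  show "X p = Y p" for p
    by (rule tangent_eqI) (use assms vector_fieldsD in \<open>auto simp: pairing_def fun_eq_iff\<close>)
qed

lemma one_form_eqI:
  assumes "\<xi> \<in> \<Omega>" "\<eta> \<in> \<Omega>" "\<And>X. X \<in> \<X> \<Longrightarrow> pairing \<xi> X = pairing \<eta> X"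
  shows "\<xi> = \<eta>"
proof
  show "\<xi> p = \<eta> p" for p
    by (rule cotangent_eqI) (use assms one_formsD in \<open>auto simp: pairing_def fun_eq_iff\<close>)
qed

text \<open>Stated for a general \<open>V\<close> so as to serve fields and forms alike. Membership
  in \<open>V\<close> is part of the induction because additivity of \<open>L\<close> is available
  only inside \<open>V\<close>.\<close>

lemma module_map_combination:
  fixes L :: "('a \<Rightarrow> 'i \<Rightarrow> 'v::real_vector) \<Rightarrow> 'a \<Rightarrow> real"
  assumes L: "module_map \<F> fscale V times \<F> L"
    and V: "0 \<in> V" "\<And>u v. u \<in> V \<Longrightarrow> v \<in> V \<Longrightarrow> u + v \<in> V" "\<And>f u. f \<in> \<F> \<Longrightarrow> u \<in> V \<Longrightarrow> fscale f u \<in> V"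
    and "\<And>i. i \<in> I \<Longrightarrow> g i \<in> \<F>" "\<And>i. i \<in> I \<Longrightarrow> X i \<in> V"
  shows "(\<lambda>p c. \<Sum>i\<in>I. g i p *\<^sub>R X i p c) \<in> V \<and>
    L (\<lambda>p c. \<Sum>i\<in>I. g i p *\<^sub>R X i p c) = (\<lambda>p. \<Sum>i\<in>I. g i p * L (X i) p)"
proof -
  \<comment> \<open>Homogeneity with the zero function yields \<open>L 0 = 0\<close>, which starts
    the induction.\<close>
  have "fscale 0 0 = (0 :: 'a \<Rightarrow> 'i \<Rightarrow> 'v)" by (simp add: fscale_def zero_fun_def)
  then have L0: "L 0 = 0"
    using L V(1) smooth_functions_zero unfolding module_map_def by (metis mult_zero_left)
  show ?thesis using assms(5,6)
  proof (induction I rule: infinite_finite_induct)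
    case (insert i I)
    let ?Y = "\<lambda>p c. \<Sum>i\<in>I. g i p *\<^sub>R X i p c"
    have eq: "(\<lambda>p c. \<Sum>i\<in>insert i I. g i p *\<^sub>R X i p c) = fscale (g i) (X i) + ?Y"
      using insert.hyps by (simp add: fscale_def plus_fun_def)
    have IH: "?Y \<in> V" "L ?Y = (\<lambda>p. \<Sum>i\<in>I. g i p * L (X i) p)"
      using insert.IH insert.prems by blast+
    have gX: "fscale (g i) (X i) \<in> V" "L (fscale (g i) (X i)) = g i * L (X i)"
      using insert.prems V(3) L by (simp_all add: module_map_def)
    have "L (u + v) = L u + L v" if "u \<in> V" "v \<in> V" for u v
      using L that by (simp add: module_map_def)
    from this[OF gX(1) IH(1)] have "L (fscale (g i) (X i) + ?Y) = g i * L (X i) + L ?Y"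
      unfolding gX(2) .
    then show ?case
      unfolding eq using IH gX V(2) insert.hyps by (simp add: plus_fun_def times_fun_def)
  qed (use V(1) L0 in \<open>simp_all add: zero_fun_def\<close>)
qed

lemma one_form_representation:
  assumes L: "module_map \<F> fscale \<X> times \<F> L"
  shows "\<exists>\<omega>\<in>\<Omega>. \<forall>X\<in>\<X>. pairing \<omega> X = L X"
proof -
  have LF: "L X \<in> \<F>" if "X \<in> \<X>" for X using L that by (simp add: module_map_def)
  have frame: "\<exists>f \<beta>. f \<in> \<F> \<and> f q \<noteq> 0 \<and> \<beta> \<in> \<Omega> \<and> (\<forall>Y\<in>\<X>. pairing \<beta> Y = f * L Y)"
    if "q \<in> topspace M" for q
    using that
  proof (rule local_frame)
    fix f X \<theta>
    assume f: "f \<in> \<F>" "f q \<noteq> 0" and X: "\<And>b. X b \<in> \<X>" and \<theta>: "\<And>b. \<theta> b \<in> \<Omega>"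
      and frame: "\<And>p v. v \<in> tangent_space A p \<Longrightarrow> (\<lambda>c. f p *\<^sub>R v c) = (\<lambda>c. \<Sum>b\<in>E. \<theta> b p v *\<^sub>R X b p c)"
    define \<beta> where "\<beta> = (\<lambda>p v. \<Sum>b\<in>E. L (X b) p *\<^sub>R \<theta> b p v)"
    have "\<beta> \<in> \<Omega>"
      unfolding \<beta>_def by (intro one_forms_combination LF X \<theta>)
    moreover have "pairing \<beta> Y = f * L Y" if Y: "Y \<in> \<X>" for Y
    proof -
      \<comment> \<open>\<open>L\<close> acts on global fields, not on vectors at a point.
        Multiplication by \<open>f\<close> makes \<open>Y\<close> a finite combination of global
        fields, to which \<open>L\<close> applies termwise.\<close>
      have "fscale f Y = (\<lambda>p c. \<Sum>b\<in>E. pairing (\<theta> b) Y p *\<^sub>R X b p c)"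
        using frame[OF vector_fieldsD(1)[OF Y]] by (simp add: fscale_def pairing_def)
      then have "L (fscale f Y) = (\<lambda>p. \<Sum>b\<in>E. pairing (\<theta> b) Y p * L (X b) p)"
        using module_map_combination[OF L, of E "\<lambda>b. pairing (\<theta> b) Y" X] X \<theta> Y
          vector_fields_zero vector_fields_add vector_fields_fscale pairing_smooth by simp
      moreover have "L (fscale f Y) = f * L Y"
        using L f(1) Y by (simp add: module_map_def)
      ultimately show ?thesis
        by (simp add: \<beta>_def pairing_def mult.commute)
    qed
    ultimately show ?thesis using f by blast
  qed
  then obtain f \<beta> where f: "\<And>q. q \<in> topspace M \<Longrightarrow> f q \<in> \<F>" "\<And>q. q \<in> topspace M \<Longrightarrow> f q q \<noteq> 0"
    and \<beta>: "\<And>q. q \<in> topspace M \<Longrightarrow> \<beta> q \<in> \<Omega>"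
      "\<And>q Y. q \<in> topspace M \<Longrightarrow> Y \<in> \<X> \<Longrightarrow> pairing (\<beta> q) Y = f q * L Y"
    by metis
  \<comment> \<open>Each point uses the pair \<open>f p\<close>, \<open>\<beta> p\<close> chosen for
    it, where \<open>f p p\<close> is nonzero. Different choices fit together because all of them
    are tied to the same \<open>L\<close>.\<close>
  define \<omega> where "\<omega> p = (if p \<in> topspace M then (\<lambda>v. inverse (f p p) *\<^sub>R \<beta> p p v) else 0)" for p
  have \<omega>_cotangent: "\<omega> p \<in> cotangent_space A p" for p
    using cotangent_space_scale[OF one_formsD(1)[OF \<beta>(1)]] cotangent_space_zero
    by (cases "p \<in> topspace M") (auto simp: \<omega>_def)
  have pair: "\<omega> p (Y p) = L Y p" if Y: "Y \<in> \<X>" for Y p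
  proof (cases "p \<in> topspace M")
    case True
    then have "\<beta> p p (Y p) = f p p * L Y p"
      using fun_cong[OF \<beta>(2)[OF True Y], of p] by (simp add: pairing_def)
    then show ?thesis using True f(2) by (simp add: \<omega>_def)
  qed (use smooth_functions_outside[OF LF[OF Y]] in \<open>simp add: \<omega>_def\<close>)
  have "\<omega> \<in> \<Omega>"
  proof (rule one_form_division[OF \<omega>_cotangent])
    fix q assume q: "q \<in> topspace M"
    \<comment> \<open>Equal pairings with all fields force this equality, so a multiple of \<omega>
      by a function nonzero at \<open>q\<close> is a smooth form and division applies.\<close>
    have "fscale (f q) \<omega> = \<beta> q"
    proof
      show "fscale (f q) \<omega> p = \<beta> q p" for p
      proof (rule cotangent_eqI)
        show "fscale (f q) \<omega> p \<in> cotangent_space A p"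
          unfolding fscale_def by (rule cotangent_space_scale[OF \<omega>_cotangent])
        show "\<beta> q p \<in> cotangent_space A p" using \<beta>(1)[OF q] by (rule one_formsD)
        show "fscale (f q) \<omega> p (Y p) = \<beta> q p (Y p)" if Y: "Y \<in> \<X>" for Y
          using fun_cong[OF \<beta>(2)[OF q Y], of p] by (simp add: fscale_def pairing_def pair[OF Y])
      qed
    qed
    then show "\<exists>f\<in>\<F>. f q \<noteq> 0 \<and> fscale f \<omega> \<in> \<Omega>"
      using f[OF q] \<beta>(1)[OF q] by metis
  qed
  then show ?thesis using pair by (auto simp: pairing_def)
qed

lemma vector_field_representation:
  assumes L: "module_map \<F> fscale \<Omega> times \<F> L"
  shows "\<exists>X\<in>\<X>. \<forall>\<xi>\<in>\<Omega>. pairing \<xi> X = L \<xi>"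
proof -
  have LF: "L \<xi> \<in> \<F>" if "\<xi> \<in> \<Omega>" for \<xi> using L that by (simp add: module_map_def)
  have frame: "\<exists>f Y. f \<in> \<F> \<and> f q \<noteq> 0 \<and> Y \<in> \<X> \<and> (\<forall>\<xi>\<in>\<Omega>. pairing \<xi> Y = f * L \<xi>)"
    if "q \<in> topspace M" for q
    using that
  proof (rule local_frame)
    fix f X \<theta>
    assume f: "f \<in> \<F>" "f q \<noteq> 0" and X: "\<And>b. X b \<in> \<X>" and \<theta>: "\<And>b. \<theta> b \<in> \<Omega>"
      and frame: "\<And>p \<alpha>. \<alpha> \<in> cotangent_space A p \<Longrightarrow> (\<lambda>v. f p *\<^sub>R \<alpha> v) = (\<lambda>v. \<Sum>b\<in>E. \<alpha> (X b p) *\<^sub>R \<theta> b p v)"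
    define Y where "Y = (\<lambda>p c. \<Sum>b\<in>E. L (\<theta> b) p *\<^sub>R X b p c)"
    have "Y \<in> \<X>"
      unfolding Y_def by (intro vector_fields_combination LF X \<theta>)
    moreover have "pairing \<xi> Y = f * L \<xi>" if \<xi>: "\<xi> \<in> \<Omega>" for \<xi>
    proof -
      have "fscale f \<xi> = (\<lambda>p v. \<Sum>b\<in>E. pairing \<xi> (X b) p *\<^sub>R \<theta> b p v)"
        using frame[OF one_formsD(1)[OF \<xi>]] by (simp add: fscale_def pairing_def)
      then have "L (fscale f \<xi>) = (\<lambda>p. \<Sum>b\<in>E. pairing \<xi> (X b) p * L (\<theta> b) p)"
        using module_map_combination[OF L, of E "\<lambda>b. pairing \<xi> (X b)" \<theta>] X \<theta> \<xi>
          one_forms_zero one_forms_add one_forms_fscale pairing_smooth by simp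
      moreover have "L (fscale f \<xi>) = f * L \<xi>"
        using L f(1) \<xi> by (simp add: module_map_def)
      \<comment> \<open>The combination now sits in the argument of \<xi>, so linearity of covectors
        is what takes it apart.\<close>
      moreover have "pairing \<xi> Y = (\<lambda>p. \<Sum>b\<in>E. L (\<theta> b) p * pairing \<xi> (X b) p)"
        unfolding Y_def pairing_def
        by (intro ext cotangent_sum[OF one_formsD(1)[OF \<xi>]] vector_fieldsD X)
      ultimately show ?thesis
        by (simp add: mult.commute)
    qed
    ultimately show ?thesis using f by blast
  qed
  then obtain f Y where f: "\<And>q. q \<in> topspace M \<Longrightarrow> f q \<in> \<F>" "\<And>q. q \<in> topspace M \<Longrightarrow> f q q \<noteq> 0"
    and Y: "\<And>q. q \<in> topspace M \<Longrightarrow> Y q \<in> \<X>"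
      "\<And>q \<xi>. q \<in> topspace M \<Longrightarrow> \<xi> \<in> \<Omega> \<Longrightarrow> pairing \<xi> (Y q) = f q * L \<xi>"
    by metis
  \<comment> \<open>Pointwise division as for forms; off the manifold the tangent space is zero,
    which forces the value 0.\<close>
  define V where "V p = (if p \<in> topspace M then (\<lambda>c. inverse (f p p) *\<^sub>R Y p p c) else 0)" for p
  have V_tangent: "V p \<in> tangent_space A p" for p
    using tangent_scale[OF vector_fieldsD(1)[OF Y(1)]] tangent_zero
    by (cases "p \<in> topspace M") (auto simp: V_def)
  have pair: "\<xi> p (V p) = L \<xi> p" if \<xi>: "\<xi> \<in> \<Omega>" for \<xi> p
  proof (cases "p \<in> topspace M")
    case True
    then have "\<xi> p (Y p p) = f p p * L \<xi> p"
      using fun_cong[OF Y(2)[OF True \<xi>], of p] by (simp add: pairing_def)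
    then show ?thesis
      using True f(2) cotangent_scale[OF one_formsD(1)[OF \<xi>] vector_fieldsD(1)[OF Y(1)[OF True]]]
      by (simp add: V_def)
  next
    case False
    then show ?thesis
      using smooth_functions_outside[OF LF[OF \<xi>]] cotangent_zero_arg[OF one_formsD(1)[OF \<xi>]]
      by (simp add: V_def)
  qed
  have "V \<in> \<X>"
  proof (rule vector_field_division[OF V_tangent])
    fix q assume q: "q \<in> topspace M"
    have "fscale (f q) V = Y q"
    proof
      show "fscale (f q) V p = Y q p" for p
      proof (rule tangent_eqI)
        show "fscale (f q) V p \<in> tangent_space A p"
          unfolding fscale_def by (rule tangent_scale[OF V_tangent])
        show "Y q p \<in> tangent_space A p" using Y(1)[OF q] by (rule vector_fieldsD)
        show "\<xi> p (fscale (f q) V p) = \<xi> p (Y q p)" if \<xi>: "\<xi> \<in> \<Omega>" for \<xi>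
          using fun_cong[OF Y(2)[OF q \<xi>], of p] cotangent_scale[OF one_formsD(1)[OF \<xi>] V_tangent]
          by (simp add: fscale_def pairing_def pair[OF \<xi>])
      qed
    qed
    then show "\<exists>f\<in>\<F>. f q \<noteq> 0 \<and> fscale f V \<in> \<X>"
      using f[OF q] Y(1)[OF q] by metis
  qed
  then show ?thesis using pair by (auto simp: pairing_def)
qed

section \<open>The natural generalized metric\<close>

abbreviation "\<Gamma> \<equiv> sections A"

lemma fscale_zero [simp]: "fscale f 0 = 0"
  by (simp add: fscale_def zero_fun_def)

lemma sections_zero: "0 \<in> \<Gamma>"
  by (simp add: sections_def zero_prod_def vector_fields_zero one_forms_zero)

lemma sections_add: "u \<in> \<Gamma> \<Longrightarrow> v \<in> \<Gamma> \<Longrightarrow> u + v \<in> \<Gamma>"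
  by (auto simp: sections_def vector_fields_add one_forms_add)

lemma sections_diff: "u \<in> \<Gamma> \<Longrightarrow> v \<in> \<Gamma> \<Longrightarrow> u - v \<in> \<Gamma>"
  using vector_fields_add[OF _ vector_fields_uminus] one_forms_add[OF _ one_forms_uminus]
  by (fastforce simp: sections_def)

lemma sections_fscale: "f \<in> \<F> \<Longrightarrow> u \<in> \<Gamma> \<Longrightarrow> fscale_section f u \<in> \<Gamma>"
  by (auto simp: sections_def fscale_section_def vector_fields_fscale one_forms_fscale)

lemma pairing_add_right:
  "\<xi> \<in> \<Omega> \<Longrightarrow> X \<in> \<X> \<Longrightarrow> Y \<in> \<X> \<Longrightarrow> pairing \<xi> (X + Y) = pairing \<xi> X + pairing \<xi> Y"
  using cotangent_add[OF one_formsD(1) vector_fieldsD(1) vector_fieldsD(1)]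
  by (simp add: pairing_def plus_fun_def[of "\<lambda>p. \<xi> p (X p)"])

lemma pairing_fscale_right:
  "\<xi> \<in> \<Omega> \<Longrightarrow> X \<in> \<X> \<Longrightarrow> pairing \<xi> (fscale f X) = f * pairing \<xi> X"
  using cotangent_scale[OF one_formsD(1) vector_fieldsD(1)]
  by (simp add: pairing_def fscale_def times_fun_def)

lemma pairing_add_left: "pairing (\<xi> + \<eta>) X = pairing \<xi> X + pairing \<eta> X"
  by (simp add: pairing_def plus_fun_def)

lemma pairing_fscale_left: "pairing (fscale f \<xi>) X = f * pairing \<xi> X"
  by (simp add: pairing_def fscale_def times_fun_def)

lemma pairing_zero_left: "pairing 0 X = 0"
  by (simp add: pairing_def zero_fun_def)

lemma pairing_zero_right: "\<xi> \<in> \<Omega> \<Longrightarrow> pairing \<xi> 0 = 0"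
  using cotangent_zero_arg[OF one_formsD(1)] by (simp add: pairing_def fun_eq_iff)

lemma natural_metric_sym: "natural_metric u v = natural_metric v u"
  by (simp add: natural_metric_def add.commute)

lemma natural_metric_smooth: "u \<in> \<Gamma> \<Longrightarrow> v \<in> \<Gamma> \<Longrightarrow> natural_metric u v \<in> \<F>"
  using smooth_functions_cmult[OF smooth_functions_add[OF pairing_smooth pairing_smooth],
      of "snd u" "fst v" "snd v" "fst u" "1/2"]
  by (auto simp: natural_metric_def sections_def)

lemma natural_metric_add:
  "u \<in> \<Gamma> \<Longrightarrow> v \<in> \<Gamma> \<Longrightarrow> w \<in> \<Gamma> \<Longrightarrow> natural_metric (u + v) w = natural_metric u w + natural_metric v w"
  by (auto simp: natural_metric_def sections_def pairing_add_left pairing_add_right fun_eq_iff algebra_simps)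

lemma natural_metric_fscale:
  "u \<in> \<Gamma> \<Longrightarrow> w \<in> \<Gamma> \<Longrightarrow> natural_metric (fscale_section f u) w = f * natural_metric u w"
  by (auto simp: natural_metric_def sections_def fscale_section_def pairing_fscale_left
      pairing_fscale_right fun_eq_iff algebra_simps)

text \<open>Symmetry carries linearity in the first argument over to the second.\<close>

lemma natural_metric_module_map:
  "u \<in> \<Gamma> \<Longrightarrow> module_map \<F> fscale_section \<Gamma> times \<F> (natural_metric u)"
  unfolding module_map_def natural_metric_sym[of u]
  by (simp add: natural_metric_smooth natural_metric_add natural_metric_fscale)

lemma natural_metric_field:
  "snd u \<in> \<Omega> \<Longrightarrow> natural_metric u (X, 0) = (\<lambda>p. 1/2 * pairing (snd u) X p)"
  by (simp add: natural_metric_def pairing_zero_left)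

lemma natural_metric_form:
  "snd u \<in> \<Omega> \<Longrightarrow> natural_metric u (0, \<xi>) = (\<lambda>p. 1/2 * pairing \<xi> (fst u) p)"
  by (simp add: natural_metric_def pairing_zero_right)

text \<open>Nondegeneracy of the natural metric: sections (0, \<xi>) detect the field part and
  sections (X, 0) the form part, and each part is determined by its pairings.\<close>

lemma natural_metric_eqI:
  assumes u: "u \<in> \<Gamma>" and w: "w \<in> \<Gamma>"
    and "\<And>v. v \<in> \<Gamma> \<Longrightarrow> natural_metric u v = natural_metric w v"
  shows "u = w"
proof (rule prod_eqI)
  have mem: "fst u \<in> \<X>" "snd u \<in> \<Omega>" "fst w \<in> \<X>" "snd w \<in> \<Omega>"
    using u w by (auto simp: sections_def)
  show "fst u = fst w"
  proof (rule vector_field_eqI[OF mem(1,3)])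
    fix \<xi> assume "\<xi> \<in> \<Omega>"
    then have "natural_metric u (0, \<xi>) = natural_metric w (0, \<xi>)"
      using assms(3) vector_fields_zero by (simp add: sections_def)
    then show "pairing \<xi> (fst u) = pairing \<xi> (fst w)"
      by (simp add: natural_metric_form mem fun_eq_iff)
  qed
  show "snd u = snd w"
  proof (rule one_form_eqI[OF mem(2,4)])
    fix X assume "X \<in> \<X>"
    then have "natural_metric u (X, 0) = natural_metric w (X, 0)"
      using assms(3) one_forms_zero by (simp add: sections_def)
    then show "pairing (snd u) X = pairing (snd w) X"
      by (simp add: natural_metric_field mem fun_eq_iff)
  qed
qed

text \<open>Forms are determined by their pairings, so the definite description in
  \<open>dual_map\<close> has at most one candidate.\<close>

lemma dual_map_unique:
  assumes "\<zeta> \<in> \<Omega>" "\<And>X. X \<in> \<X> \<Longrightarrow> pairing \<zeta> X = pairing \<xi> (H X)"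
  shows "dual_map A H \<xi> = \<zeta>"
  unfolding dual_map_def by (rule the_equality) (use assms in \<open>auto intro: one_form_eqI\<close>)

text \<open>The functional sending X to \<xi>(H X) is function-linear, so a representing form exists
  and the definite description is met.\<close>

lemma dual_map:
  assumes H: "module_map \<F> fscale \<X> fscale \<X> H" and \<xi>: "\<xi> \<in> \<Omega>"
  shows "dual_map A H \<xi> \<in> \<Omega>" "\<And>X. X \<in> \<X> \<Longrightarrow> pairing (dual_map A H \<xi>) X = pairing \<xi> (H X)"
proof -
  have "module_map \<F> fscale \<X> times \<F> (\<lambda>X. pairing \<xi> (H X))"
    using H \<xi> by (simp add: module_map_def pairing_smooth pairing_add_right pairing_fscale_right)
  then obtain \<zeta> where \<zeta>: "\<zeta> \<in> \<Omega>" "\<And>X. X \<in> \<X> \<Longrightarrow> pairing \<zeta> X = pairing \<xi> (H X)"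
    using one_form_representation by blast
  then show "dual_map A H \<xi> \<in> \<Omega>" "\<And>X. X \<in> \<X> \<Longrightarrow> pairing (dual_map A H \<xi>) X = pairing \<xi> (H X)"
    using dual_map_unique[of \<zeta> \<xi> H] by auto
qed

lemma section_split: "(X :: ('a, 'e) vfield, \<xi> :: ('a, 'e) oneform) = (X, 0) + (0, \<xi>)"
  by simp

text \<open>The natural metric pairs the summands crosswise: the form part \<alpha> of
  \<open>K u\<close> represents \<open>G u\<close> on fields, and its field part \<open>V\<close>
  represents \<open>G u\<close> on forms.\<close>

lemma metric_representation:
  assumes "generalized_metric M A G"
  obtains K where "\<And>u. u \<in> \<Gamma> \<Longrightarrow> K u \<in> \<Gamma>"
    "\<And>u v. u \<in> \<Gamma> \<Longrightarrow> v \<in> \<Gamma> \<Longrightarrow> G u v = natural_metric (K u) v"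
proof -
  have "\<exists>k\<in>\<Gamma>. \<forall>v\<in>\<Gamma>. G u v = natural_metric k v" if u: "u \<in> \<Gamma>" for u
  proof -
    have G: "module_map \<F> fscale_section \<Gamma> times \<F> (G u)"
      using assms u by (simp add: generalized_metric_def)
    have inX: "(X, 0) \<in> \<Gamma>" if "X \<in> \<X>" for X using that one_forms_zero by (simp add: sections_def)
    have in\<Omega>: "(0, \<xi>) \<in> \<Gamma>" if "\<xi> \<in> \<Omega>" for \<xi> using that vector_fields_zero by (simp add: sections_def)
    have G_add: "G u (v + w) = G u v + G u w" if "v \<in> \<Gamma>" "w \<in> \<Gamma>" for v w
      using G that by (simp add: module_map_def)
    have G_scale: "G u (fscale_section f v) = f * G u v" if "f \<in> \<F>" "v \<in> \<Gamma>" for f v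
      using G that by (simp add: module_map_def)
    have G_smooth: "G u v \<in> \<F>" if "v \<in> \<Gamma>" for v
      using G that by (simp add: module_map_def)
    \<comment> \<open>The factor 2 cancels the 1/2 in \<open>natural_metric\<close>.\<close>
    have "module_map \<F> fscale \<X> times \<F> (\<lambda>X p. 2 * G u (X, 0) p)"
      unfolding module_map_def
    proof (intro conjI ballI)
      show "(\<lambda>p. 2 * G u (X, 0) p) \<in> \<F>" if "X \<in> \<X>" for X
        by (rule smooth_functions_cmult[OF G_smooth[OF inX[OF that]]])
      show "(\<lambda>p. 2 * G u (X + Y, 0) p) = (\<lambda>p. 2 * G u (X, 0) p) + (\<lambda>p. 2 * G u (Y, 0) p)"
        if "X \<in> \<X>" "Y \<in> \<X>" for X Y
        using G_add[OF inX inX, OF that] by (simp add: plus_fun_def[of "\<lambda>p. 2 * _ p"] algebra_simps)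
      show "(\<lambda>p. 2 * G u (fscale f X, 0) p) = f * (\<lambda>p. 2 * G u (X, 0) p)"
        if "f \<in> \<F>" "X \<in> \<X>" for f X
        using G_scale[OF that(1) inX[OF that(2)]] by (simp add: fscale_section_def times_fun_def algebra_simps)
    qed
    then obtain \<alpha> where \<alpha>: "\<alpha> \<in> \<Omega>" "\<And>X. X \<in> \<X> \<Longrightarrow> pairing \<alpha> X = (\<lambda>p. 2 * G u (X, 0) p)"
      using one_form_representation by blast
    have "module_map \<F> fscale \<Omega> times \<F> (\<lambda>\<xi> p. 2 * G u (0, \<xi>) p)"
      unfolding module_map_def
    proof (intro conjI ballI)
      show "(\<lambda>p. 2 * G u (0, \<xi>) p) \<in> \<F>" if "\<xi> \<in> \<Omega>" for \<xi>
        by (rule smooth_functions_cmult[OF G_smooth[OF in\<Omega>[OF that]]])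
      show "(\<lambda>p. 2 * G u (0, \<xi> + \<eta>) p) = (\<lambda>p. 2 * G u (0, \<xi>) p) + (\<lambda>p. 2 * G u (0, \<eta>) p)"
        if "\<xi> \<in> \<Omega>" "\<eta> \<in> \<Omega>" for \<xi> \<eta>
        using G_add[OF in\<Omega> in\<Omega>, OF that] by (simp add: plus_fun_def[of "\<lambda>p. 2 * _ p"] algebra_simps)
      show "(\<lambda>p. 2 * G u (0, fscale f \<xi>) p) = f * (\<lambda>p. 2 * G u (0, \<xi>) p)"
        if "f \<in> \<F>" "\<xi> \<in> \<Omega>" for f \<xi>
        using G_scale[OF that(1) in\<Omega>[OF that(2)]] by (simp add: fscale_section_def times_fun_def algebra_simps)
    qed
    then obtain V where V: "V \<in> \<X>" "\<And>\<xi>. \<xi> \<in> \<Omega> \<Longrightarrow> pairing \<xi> V = (\<lambda>p. 2 * G u (0, \<xi>) p)"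
      using vector_field_representation by blast
    have "G u (X, \<xi>) = natural_metric (V, \<alpha>) (X, \<xi>)" if "X \<in> \<X>" "\<xi> \<in> \<Omega>" for X \<xi>
      unfolding section_split[of X \<xi>] G_add[OF inX[OF that(1)] in\<Omega>[OF that(2)]]
      using that by (simp add: natural_metric_def \<alpha> V fun_eq_iff)
    then show ?thesis
      using \<alpha>(1) V(1) by (auto simp: sections_def)
  qed
  then show thesis using that by metis
qed

section \<open>The correspondence between generalized metrics and endomorphisms\<close>

lemma generalized_metric_endomorphism:
  assumes G: "generalized_metric M A G"
  shows "\<exists>K. injective_endomorphism M A K \<and>
     (\<forall>u\<in>\<Gamma>. \<forall>v\<in>\<Gamma>. G u v = natural_metric (K u) v) \<and>
     (\<exists>H \<sigma> \<tau>. symmetric_matrix_form M A K H \<sigma> \<tau>)"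
proof -
  obtain K where K: "\<And>u. u \<in> \<Gamma> \<Longrightarrow> K u \<in> \<Gamma>"
    and GK: "\<And>u v. u \<in> \<Gamma> \<Longrightarrow> v \<in> \<Gamma> \<Longrightarrow> G u v = natural_metric (K u) v"
    using metric_representation[OF G] by blast
  have G_sym: "G u v = G v u" if "u \<in> \<Gamma>" "v \<in> \<Gamma>" for u v
    using G that by (simp add: generalized_metric_def)
  have G_add: "G (u + v) w = G u w + G v w" if "u \<in> \<Gamma>" "v \<in> \<Gamma>" "w \<in> \<Gamma>" for u v w
    using G that by (simp add: generalized_metric_def module_map_def)
  have G_scale: "G (fscale_section f u) w = f * G u w" if "f \<in> \<F>" "u \<in> \<Gamma>" "w \<in> \<Gamma>" for f u w
    using G that by (simp add: generalized_metric_def module_map_def)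
  \<comment> \<open>So far \<open>K\<close> is only a choice of representing sections. It is
    additive because both sides have the same natural product with every section.\<close>
  have K_add: "K (u + v) = K u + K v" if "u \<in> \<Gamma>" "v \<in> \<Gamma>" for u v
    by (rule natural_metric_eqI)
       (use that in \<open>simp_all add: K sections_add natural_metric_add G_add flip: GK\<close>)
  have K_scale: "K (fscale_section f u) = fscale_section f (K u)" if "f \<in> \<F>" "u \<in> \<Gamma>" for f u
    by (rule natural_metric_eqI)
       (use that in \<open>simp_all add: K sections_fscale natural_metric_fscale G_scale flip: GK\<close>)
  have "inj_on K \<Gamma>"
  proof (rule inj_onI)
    fix u v assume uv: "u \<in> \<Gamma>" "v \<in> \<Gamma>" "K u = K v"
    \<comment> \<open>Additivity is applied to u = (u - v) + v; nondegeneracy of \<open>G\<close>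
      then gives u - v = 0.\<close>
    have "G (u - v) w = 0" if w: "w \<in> \<Gamma>" for w
    proof -
      have "G u w = G (u - v) w + G v w"
        using G_add[OF sections_diff[OF uv(1,2)] uv(2) w] by simp
      moreover have "G u w = G v w" using uv w by (simp add: GK)
      ultimately show ?thesis by simp
    qed
    then have "u - v = 0"
      using G sections_diff[OF uv(1,2)] unfolding generalized_metric_def by blast
    then show "u = v" by simp
  qed
  then have "injective_endomorphism M A K"
    by (simp add: injective_endomorphism_def module_map_def K K_add K_scale)
  \<comment> \<open>The matrix entries are the restrictions of \<open>K\<close> to the two summands
    followed by the projections.\<close>
  moreover have "symmetric_matrix_form M A K (\<lambda>X. fst (K (X, 0))) (\<lambda>\<xi>. fst (K (0, \<xi>))) (\<lambda>X. snd (K (X, 0)))"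
  proof -
    have inX: "(X, 0) \<in> \<Gamma>" if "X \<in> \<X>" for X using that one_forms_zero by (simp add: sections_def)
    have in\<Omega>: "(0, \<xi>) \<in> \<Gamma>" if "\<xi> \<in> \<Omega>" for \<xi> using that vector_fields_zero by (simp add: sections_def)
    have fst_K: "fst (K u) \<in> \<X>" and snd_K: "snd (K u) \<in> \<Omega>" if "u \<in> \<Gamma>" for u
      using K[OF that] by (auto simp: sections_def)
    have pairX: "pairing (snd (K u)) X = (\<lambda>p. 2 * G u (X, 0) p)" if "u \<in> \<Gamma>" "X \<in> \<X>" for u X
      using that by (simp add: GK inX natural_metric_field snd_K)
    have pair\<Omega>: "pairing \<xi> (fst (K u)) = (\<lambda>p. 2 * G u (0, \<xi>) p)" if "u \<in> \<Gamma>" "\<xi> \<in> \<Omega>" for u \<xi>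
      using that by (simp add: GK in\<Omega> natural_metric_form snd_K)
    have addX: "K (X + Y, 0) = K (X, 0) + K (Y, 0)" if "X \<in> \<X>" "Y \<in> \<X>" for X Y
      using K_add[OF inX inX, OF that] by simp
    have add\<Omega>: "K (0, \<xi> + \<eta>) = K (0, \<xi>) + K (0, \<eta>)" if "\<xi> \<in> \<Omega>" "\<eta> \<in> \<Omega>" for \<xi> \<eta>
      using K_add[OF in\<Omega> in\<Omega>, OF that] by simp
    have scaleX: "K (fscale f X, 0) = fscale_section f (K (X, 0))" if "f \<in> \<F>" "X \<in> \<X>" for f X
      using K_scale[OF that(1) inX[OF that(2)]] by (simp add: fscale_section_def)
    have scale\<Omega>: "K (0, fscale f \<xi>) = fscale_section f (K (0, \<xi>))" if "f \<in> \<F>" "\<xi> \<in> \<Omega>" for f \<xi>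
      using K_scale[OF that(1) in\<Omega>[OF that(2)]] by (simp add: fscale_section_def)
    \<comment> \<open>The lower right entry is the dual of \<open>H\<close> by symmetry of
      \<open>G\<close> on mixed pairs (0, \<xi>), (X, 0); pairs of fields and pairs of forms give
      the conditions on \<tau> and \<sigma>.\<close>
    have dual: "dual_map A (\<lambda>X. fst (K (X, 0))) \<xi> = snd (K (0, \<xi>))" if \<xi>: "\<xi> \<in> \<Omega>" for \<xi>
    proof (rule dual_map_unique)
      show "snd (K (0, \<xi>)) \<in> \<Omega>" using \<xi> in\<Omega> snd_K by blast
      show "pairing (snd (K (0, \<xi>))) X = pairing \<xi> (fst (K (X, 0)))" if "X \<in> \<X>" for X
        using \<xi> that by (simp add: pairX pair\<Omega> inX in\<Omega> G_sym[of "(0, \<xi>)"])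
    qed
    have split: "K (X, \<xi>) = K (X, 0) + K (0, \<xi>)" if "X \<in> \<X>" "\<xi> \<in> \<Omega>" for X \<xi>
      using K_add[OF inX[OF that(1)] in\<Omega>[OF that(2)]] by simp
    show ?thesis
      unfolding symmetric_matrix_form_def module_map_def
    proof (intro conjI ballI)
      fix X \<xi> assume "X \<in> \<X>" "\<xi> \<in> \<Omega>"
      then show "K (X, \<xi>) = (fst (K (X, 0)) + fst (K (0, \<xi>)),
          snd (K (X, 0)) + dual_map A (\<lambda>X. fst (K (X, 0))) \<xi>)"
        by (simp add: split dual plus_prod_def)
    next
      fix X Y assume "X \<in> \<X>" "Y \<in> \<X>"
      then show "pairing (snd (K (X, 0))) Y = pairing (snd (K (Y, 0))) X"
        by (simp add: pairX inX G_sym[of "(X, 0)"])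
    next
      fix \<xi> \<eta> assume "\<xi> \<in> \<Omega>" "\<eta> \<in> \<Omega>"
      then show "pairing \<xi> (fst (K (0, \<eta>))) = pairing \<eta> (fst (K (0, \<xi>)))"
        by (simp add: pair\<Omega> in\<Omega> G_sym[of "(0, \<xi>)"])
    qed (simp_all add: addX add\<Omega> scaleX scale\<Omega> fst_K snd_K inX in\<Omega> fscale_section_def)
  qed
  ultimately show ?thesis using GK by blast
qed

lemma endomorphism_generalized_metric:
  assumes K: "injective_endomorphism M A K" and form: "symmetric_matrix_form M A K H \<sigma> \<tau>"
  shows "generalized_metric M A (\<lambda>u v. natural_metric (K u) v)"
proof -
  have K_in: "K u \<in> \<Gamma>" if "u \<in> \<Gamma>" for u
    using K that by (simp add: injective_endomorphism_def module_map_def)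
  have K_add: "K (u + v) = K u + K v" if "u \<in> \<Gamma>" "v \<in> \<Gamma>" for u v
    using K that by (simp add: injective_endomorphism_def module_map_def)
  have K_scale: "K (fscale_section f u) = fscale_section f (K u)" if "f \<in> \<F>" "u \<in> \<Gamma>" for f u
    using K that by (simp add: injective_endomorphism_def module_map_def)
  have H: "module_map \<F> fscale \<X> fscale \<X> H"
    using form by (simp add: symmetric_matrix_form_def)
  have H_in: "H X \<in> \<X>" if "X \<in> \<X>" for X
    using H that by (simp add: module_map_def)
  have \<sigma>_in: "\<sigma> \<xi> \<in> \<X>" if "\<xi> \<in> \<Omega>" for \<xi>
    using form that by (simp add: symmetric_matrix_form_def module_map_def)
  have \<tau>_sym: "pairing (\<tau> X) Y = pairing (\<tau> Y) X" if "X \<in> \<X>" "Y \<in> \<X>" for X Y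
    using form that unfolding symmetric_matrix_form_def by blast
  have \<sigma>_sym: "pairing \<xi> (\<sigma> \<eta>) = pairing \<eta> (\<sigma> \<xi>)" if "\<xi> \<in> \<Omega>" "\<eta> \<in> \<Omega>" for \<xi> \<eta>
    using form that unfolding symmetric_matrix_form_def by blast
  have K_eq: "K (X, \<xi>) = (H X + \<sigma> \<xi>, \<tau> X + dual_map A H \<xi>)" if "X \<in> \<X>" "\<xi> \<in> \<Omega>" for X \<xi>
    using form that unfolding symmetric_matrix_form_def by blast
  \<comment> \<open>Exchanging the two sections fixes the first and last terms, by symmetry of
    \<tau> and \<sigma>, and swaps the two middle terms, which come from \<open>H\<close> and its
    dual.\<close>
  have expand: "natural_metric (K (X, \<xi>)) (Y, \<eta>)
      = (\<lambda>p. 1/2 * (pairing (\<tau> X) Y p + pairing \<xi> (H Y) p + pairing \<eta> (H X) p + pairing \<eta> (\<sigma> \<xi>) p))"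
    if "X \<in> \<X>" "\<xi> \<in> \<Omega>" "Y \<in> \<X>" "\<eta> \<in> \<Omega>" for X \<xi> Y \<eta>
    using that by (simp add: K_eq natural_metric_def pairing_add_left pairing_add_right
        H_in \<sigma>_in dual_map[OF H] fun_eq_iff)
  have sym: "natural_metric (K u) v = natural_metric (K v) u" if "u \<in> \<Gamma>" "v \<in> \<Gamma>" for u v
  proof -
    obtain X \<xi> Y \<eta> where eq: "u = (X, \<xi>)" "v = (Y, \<eta>)" "X \<in> \<X>" "\<xi> \<in> \<Omega>" "Y \<in> \<X>" "\<eta> \<in> \<Omega>"
      using \<open>u \<in> \<Gamma>\<close> \<open>v \<in> \<Gamma>\<close> by (auto simp: sections_def)
    show ?thesis
      unfolding eq(1,2) expand[OF eq(3-6)] expand[OF eq(5,6,3,4)]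
      using \<tau>_sym[OF eq(3,5)] \<sigma>_sym[OF eq(4,6)] by (simp add: fun_eq_iff algebra_simps)
  qed
  have nondegenerate: "u = 0" if u: "u \<in> \<Gamma>" and 0: "\<And>v. v \<in> \<Gamma> \<Longrightarrow> natural_metric (K u) v = 0" for u
  proof -
    \<comment> \<open>If \<open>K u\<close> is orthogonal to everything, nondegeneracy of the
      natural metric gives \<open>K u = 0\<close>, so injectivity needs only \<open>K 0 = 0\<close>
      to conclude.\<close>
    have "K (0 + 0) = K 0 + K 0" by (rule K_add[OF sections_zero sections_zero])
    then have K0: "K 0 = 0" by simp
    have "natural_metric 0 v = 0" if "v \<in> \<Gamma>" for v
      using natural_metric_add[OF sections_zero sections_zero that] by simp
    then have "K u = 0"
      using u 0 by (intro natural_metric_eqI) (simp_all add: K_in sections_zero)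
    then show ?thesis
      using K K0 u sections_zero by (metis injective_endomorphism_def inj_onD)
  qed
  have "module_map \<F> fscale_section \<Gamma> times \<F> (\<lambda>u. natural_metric (K u) v)" if "v \<in> \<Gamma>" for v
    using that by (simp add: module_map_def K_in K_add K_scale natural_metric_smooth
        natural_metric_add natural_metric_fscale)
  then show ?thesis
    using sym nondegenerate natural_metric_module_map[OF K_in]
    unfolding generalized_metric_def by blast
qed

end

theorem proposition3p1:
  fixes M :: "'a topology" and A :: "('a, 'e::real_inner) chart set"
  assumes "smooth_manifold M A"
  shows "(\<forall>G. generalized_metric M A G \<longrightarrow>
           (\<exists>K. injective_endomorphism M A K \<and>
              (\<forall>u\<in>sections A. \<forall>v\<in>sections A. G u v = natural_metric (K u) v) \<and>
              (\<exists>H \<sigma> \<tau>. symmetric_matrix_form M A K H \<sigma> \<tau>))) \<and>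
         (\<forall>K. injective_endomorphism M A K \<and>
              (\<exists>H \<sigma> \<tau>. symmetric_matrix_form M A K H \<sigma> \<tau>) \<longrightarrow>
           generalized_metric M A (\<lambda>u v. natural_metric (K u) v))"
proof -
  \<comment> \<open>The basis is auxiliary: neither the definitions nor the conclusion mention it,
    so any choice does.\<close>
  obtain E :: "'e set" where "expansion_basis E"
    using assms expansion_basis_exists by (auto simp: smooth_manifold_def)
  then interpret manifold_with_basis M A E
    using assms by unfold_locales
  show ?thesis
    using generalized_metric_endomorphism endomorphism_generalized_metric by blast
qed

end
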